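(* Let $\mathcal S\subset\mathbb R^{2n}$ satisfy Assumption 1, let $A^*$ be the chosen target polynomial and $\underline\lambda$ the largest modulus of a root of $z^{2n}A^*(z^{-1})$. For every $\delta\in(0,\infty]$ and $\lambda\in(\underline\lambda,1)$ there exists $c>0$ such that for every $t_0\in\mathbb Z$, $\theta_0\in\mathcal S$, $\theta^*\in\mathcal S$, $\phi_0\in\mathbb R^{2n}$ and $y^*,d\in\ell_\infty$, when the adaptive controller (the estimator with parameter $\delta$ and $\hat\theta(t_0)=\theta_0$, together with the pole placement control law, as described in the context) is applied to the plant $y(t+1)=\phi(t)^T\theta^*+d(t)$, $\phi(t_0)=\phi_0$, $t\ge t_0$, the following bound holds: $$\|\phi(k)\|\le c\lambda^{k-t_0}\|\phi_0\|+\sum_{j=t_0}^{k-1}c\,\lambda^{k-1-j}\bigl(|r(j)|+|d(j)|\bigr),\qquad k\ge t_0,$$ where $r(t)=\sum_{i=1}^n\hat p_i(t)\,y^*(t+1-i)$.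
   Context: Norms: $\|\cdot\|$ is the Euclidean norm on vectors and the induced norm on matrices. $\ell_\infty$ is the set of bounded sequences indexed by $\mathbb Z$ (here real-valued). Plant. Fix $n\in\mathbb N$. For real sequences $y,u$ put $\phi(t)=[y(t),\dots,y(t-n+1),u(t),\dots,u(t-n+1)]^T\in\mathbb R^{2n}$. The plant is $y(t+1)=\phi(t)^T\theta^*+d(t)$, $t\ge t_0$, $\phi(t_0)=\phi_0$ (so $\phi_0$ specifies $y(t_0),\dots,y(t_0-n+1),u(t_0),\dots,u(t_0-n+1)$), with $\theta^*=[-a_1,\dots,-a_n,b_1,\dots,b_n]^T$ the plant parameter, $d$ the disturbance, $u$ the control input, $y$ the output. Associated polynomials: $A(z^{-1})=1+a_1z^{-1}+\dots+a_nz^{-n}$, $B(z^{-1})=b_1z^{-1}+\dots+b_nz^{-n}$. Assumption 1 on the (fixed, known) parameter set $\mathcal S\subset\mathbb R^{2n}$: $\mathcal S$ is (nonempty) convex and compact, and for each $\theta^*\in\mathcal S$ the corresponding $A(z^{-1})$ and $B(z^{-1})$ are coprime, in the sense that $z^nA(z^{-1})$ and $z^nB(z^{-1})$ are coprime polynomials in $z$. Put $\|\mathcal S\|=\max_{x\in\mathcal S}\|x\|$ and let $\pi_{\mathcal S}:\mathbb R^{2n}\to\mathcal S$ be the Euclidean projection onto $\mathcal S$. Estimator. Let $\delta\in(0,\infty]$, with the convention $\infty\cdot 0=0$. Set $\hat\theta(t_0)=\theta_0\in\mathcal S$ and, for $t\ge t_0$, let $e(t+1)=y(t+1)-\phi(t)^T\hat\theta(t)$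 (prediction error). Define $\rho_\delta(\phi(t),e(t+1))=1$ if $|e(t+1)|<(2\|\mathcal S\|+\delta)\|\phi(t)\|$ and $=0$ otherwise (so it is $0$ when $\phi(t)=0$). Then $$\check\theta(t+1)=\hat\theta(t)+\rho_\delta(\phi(t),e(t+1))\frac{\phi(t)}{\phi(t)^T\phi(t)}e(t+1),\qquad \hat\theta(t+1)=\pi_{\mathcal S}(\check\theta(t+1)),$$ where the update term is taken to be $0$ whenever $\rho_\delta=0$. Control law. Fix once and for all $A^*(z^{-1})=1+a_1^*z^{-1}+\dots+a_{2n}^*z^{-2n}$ such that all zeros of $z^{2n}A^*(z^{-1})$ lie in the open unit disk; $\underline\lambda=\max\{|\lambda|:\lambda\text{ a root of }z^{2n}A^*(z^{-1})\}$. Write $\hat\theta(t)=[-\hat a_1(t),\dots,-\hat a_n(t),\hat b_1(t),\dots,\hat b_n(t)]^T$, $\hat A(t,z^{-1})=1+\sum_{i=1}^n\hat a_i(t)z^{-i}$, $\hat B(t,z^{-1})=\sum_{i=1}^n\hat b_i(t)z^{-i}$, and let $\hat L(t,z^{-1})=1+\sum_{i=1}^n\hat l_i(t)z^{-i}$, $\hat P(t,z^{-1})=\sum_{i=1}^n\hat p_i(t)z^{-i}$ be the unique polynomials of this form with $\hat A\hat L+\hat B\hat P=A^*$. For an exogenous reference signal $y^*$ (a sequence on $\mathbb Z$), the control is, for $t\ge t_0+1$, $$u(t)=-\sum_{i=1}^n\hat l_i(t-1)u(t-i)-\sum_{i=1}^n\hat p_i(t-1)\,[y(t-i)-y^*(t-i)].$$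 *)

theory Defs
  imports "HOL-Analysis.Analysis" "HOL-Computational_Algebra.Polynomial_Factorial"
    "HOL-Computational_Algebra.Field_as_Ring"
begin

unbundle no fps_syntax

text \<open>
  The plant order \<open>n\<close> is \<open>CARD('n)\<close>; the linear order on \<open>'n\<close> labels its elements by \<open>1, \<dots>, n\<close>.
  Parameters and regressors live in \<open>real ^ ('n + 'n)\<close>: the components \<open>Inl i\<close> form the first
  half of the vector, the components \<open>Inr i\<close> the second half.
\<close>

type_synonym 'n coeffs = "(real, 'n) vec"
type_synonym 'n param = "(real, 'n + 'n) vec"

definition idx :: "'n::{finite,linorder} \<Rightarrow> nat"
  where "idx i = card {..i}"

lemma bij_betw_idx: "bij_betw idx (UNIV :: 'n::{finite,linorder} set) {1..CARD('n)}"
proof -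
  have less: "idx i < idx j" if "i < j" for i j :: 'n
    unfolding idx_def using that by (intro psubset_card_mono) auto
  have inj: "inj (idx :: 'n \<Rightarrow> nat)"
    by (metis injI less less_irrefl linorder_neqE)
  have "idx ` (UNIV :: 'n set) \<subseteq> {1..CARD('n)}"
    by (auto simp: idx_def Suc_le_eq card_gt_0_iff card_mono)
  with inj show ?thesis
    by (intro bij_betw_imageI card_subset_eq) (auto simp: card_image)
qed


subsection \<open>Polynomials in the backward shift\<close>

text \<open>
  Polynomials such as \<open>A(z\<^sup>-\<^sup>1)\<close> are values of type \<open>real poly\<close> whose indeterminate stands
  for \<open>z\<^sup>-\<^sup>1\<close>. For \<open>degree p \<le> m\<close>, \<open>z_mult m p\<close> is \<open>z\<^sup>m p(z\<^sup>-\<^sup>1)\<close>, a polynomial in \<open>z\<close>.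
\<close>

definition z_mult :: "nat \<Rightarrow> real poly \<Rightarrow> real poly"
  where "z_mult m p = (\<Sum>i\<le>m. monom (coeff p i) (m - i))"

definition shift_poly :: "'n::{finite,linorder} coeffs \<Rightarrow> real poly"
  where "shift_poly v = (\<Sum>i\<in>UNIV. monom (v $ i) (idx i))"

definition A_poly :: "'n::{finite,linorder} param \<Rightarrow> real poly"
  where "A_poly \<theta> = 1 + shift_poly (\<chi> i. - (\<theta> $ Inl i))"

definition B_poly :: "'n::{finite,linorder} param \<Rightarrow> real poly"
  where "B_poly \<theta> = shift_poly (\<chi> i. \<theta> $ Inr i)"

definition admissible_params :: "'n::{finite,linorder} param set \<Rightarrow> bool"
  where "admissible_params S \<longleftrightarrow>
    S \<noteq> {} \<and> convex S \<and> compact S \<and>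
    (\<forall>\<theta>\<in>S. coprime (z_mult CARD('n) (A_poly \<theta>)) (z_mult CARD('n) (B_poly \<theta>)))"

definition z_roots :: "nat \<Rightarrow> real poly \<Rightarrow> complex set"
  where "z_roots m p = {z. poly (map_poly complex_of_real (z_mult m p)) z = 0}"

definition stable_target :: "nat \<Rightarrow> real poly \<Rightarrow> bool"
  where "stable_target m Astar \<longleftrightarrow>
    coeff Astar 0 = 1 \<and> degree Astar \<le> m \<and> (\<forall>z\<in>z_roots m Astar. norm z < 1)"

definition max_root_modulus :: "nat \<Rightarrow> real poly \<Rightarrow> real"
  where "max_root_modulus m p = Max (norm ` z_roots m p)"


subsection \<open>Estimator\<close>

definition regressor ::
    "(int \<Rightarrow> real) \<Rightarrow> (int \<Rightarrow> real) \<Rightarrow> int \<Rightarrow> 'n::{finite,linorder} param"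
  where "regressor y u t =
    (\<chi> k. case k of Inl i \<Rightarrow> y (t + 1 - int (idx i)) | Inr i \<Rightarrow> u (t + 1 - int (idx i)))"

definition set_norm :: "'a::real_normed_vector set \<Rightarrow> real"
  where "set_norm S = (SUP x\<in>S. norm x)"

text \<open>
  In \<open>ereal\<close> one has \<open>\<infinity> * 0 = 0\<close>, so \<open>rho\<close> vanishes at \<open>\<phi> = 0\<close> also for \<open>\<delta> = \<infinity>\<close>.
\<close>

definition rho :: "'a::euclidean_space set \<Rightarrow> ereal \<Rightarrow> 'a \<Rightarrow> real \<Rightarrow> real"
  where "rho S \<delta> \<phi> e =
    (if ereal \<bar>e\<bar> < (ereal (2 * set_norm S) + \<delta>) * ereal (norm \<phi>) then 1 else 0)"

definition estimator_step ::
    "'a::euclidean_space set \<Rightarrow> ereal \<Rightarrow> 'a \<Rightarrow> real \<Rightarrow> 'a \<Rightarrow> 'a"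
  where "estimator_step S \<delta> \<phi> e \<theta> =
    closest_point S (\<theta> + rho S \<delta> \<phi> e *\<^sub>R ((e / (\<phi> \<bullet> \<phi>)) *\<^sub>R \<phi>))"


subsection \<open>Pole placement control law\<close>

text \<open>
  The pair of coefficient vectors \<open>(l, p)\<close> of \<open>L = 1 + l\<^sub>1 z\<^sup>-\<^sup>1 + \<dots> + l\<^sub>n z\<^sup>-\<^sup>n\<close> and
  \<open>P = p\<^sub>1 z\<^sup>-\<^sup>1 + \<dots> + p\<^sub>n z\<^sup>-\<^sup>n\<close>.
\<close>

definition pole_placement_gains ::
    "real poly \<Rightarrow> 'n::{finite,linorder} param \<Rightarrow> 'n coeffs \<times> 'n coeffs"
  where "pole_placement_gains Astar \<theta> =
    (THE (l, p). A_poly \<theta> * (1 + shift_poly l) + B_poly \<theta> * shift_poly p = Astar)"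

lemma coeff_z_mult: "coeff (z_mult m p) j = (if j \<le> m then coeff p (m - j) else 0)"
proof -
  have "coeff (z_mult m p) j = (\<Sum>i\<le>m. if m - i = j then coeff p i else 0)"
    by (simp add: z_mult_def coeff_sum)
  also have "\<dots> = (\<Sum>i\<le>m. if i = m - j then (if j \<le> m then coeff p i else 0) else 0)"
    by (intro sum.cong) auto
  finally show ?thesis by (auto simp: sum.delta)
qed

lemma z_mult_reflect:
  assumes "degree p \<le> m" shows "z_mult m p = monom 1 (m - degree p) * reflect_poly p"
proof (rule poly_eqI)
  fix j
  show "coeff (z_mult m p) j = coeff (monom 1 (m - degree p) * reflect_poly p) j"
    using assms by (auto simp: coeff_z_mult coeff_monom_mult coeff_reflect_poly coeff_eq_0
       intro!: arg_cong[where f="coeff p"] coeff_eq_0)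
qed

lemma z_mult_mult:
  assumes "degree p \<le> a" "degree q \<le> b"
  shows "z_mult (a + b) (p * q) = z_mult a p * z_mult b q"
proof (cases "p = 0 \<or> q = 0")
  case True
  then show ?thesis by (auto simp: z_mult_def)
next
  case False
  then have "degree (p * q) = degree p + degree q" by (simp add: degree_mult_eq)
  moreover have "a + b - (degree p + degree q) = (a - degree p) + (b - degree q)"
    using assms by simp
  ultimately show ?thesis
    using assms mult_monom[of "1::real" "a - degree p" 1 "b - degree q"]
    by (simp add: z_mult_reflect reflect_poly_mult mult_ac)
qed

lemma z_mult_0: "z_mult m 0 = 0"
  by (simp add: z_mult_def)

lemma z_mult_add: "z_mult m (p + q) = z_mult m p + z_mult m q"
  by (rule poly_eqI) (simp add: coeff_z_mult)

lemma inj_idx: "idx i = idx j \<longleftrightarrow> i = j"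
  using bij_betw_idx by (metis UNIV_I bij_betw_def inj_on_def)

lemma idx_bounds: "1 \<le> idx (i::'n::{finite,linorder})" "idx i \<le> CARD('n)"
  using bij_betw_idx[where 'n='n] by (auto simp: bij_betw_def set_eq_iff)

lemma coeff_shift_poly_idx: "coeff (shift_poly v) (idx i) = v $ i"
  by (simp add: shift_poly_def coeff_sum inj_idx)

lemma coeff_shift_poly_0: "coeff (shift_poly v) 0 = 0"
  unfolding shift_poly_def coeff_sum using idx_bounds(1)
  by (metis (mono_tags, lifting) coeff_monom not_one_le_zero sum.neutral)

lemma degree_shift_poly: "degree (shift_poly (v :: 'n::{finite,linorder} coeffs)) \<le> CARD('n)"
  unfolding shift_poly_def
  by (intro degree_sum_le) (auto intro: order.trans[OF degree_monom_le] idx_bounds)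

lemma shift_poly_eq_0: "shift_poly v = 0 \<Longrightarrow> v = 0"
  by (metis coeff_0 coeff_shift_poly_idx vec_eq_iff zero_index)

lemma shift_poly_add: "shift_poly (v + w) = shift_poly v + shift_poly w"
  by (simp add: shift_poly_def sum.distrib add_monom[symmetric])

lemma shift_poly_scale: "shift_poly (c *\<^sub>R v) = smult c (shift_poly v)"
  by (rule poly_eqI) (simp add: shift_poly_def coeff_sum sum_distrib_left if_distrib[where f="(*) c"] cong: if_cong)

lemma diophantine_inj:
  fixes \<theta> :: "'n::{finite,linorder} param"
  assumes co: "coprime (z_mult CARD('n) (A_poly \<theta>)) (z_mult CARD('n) (B_poly \<theta>))"
    and eq: "A_poly \<theta> * shift_poly (l :: 'n coeffs) + B_poly \<theta> * shift_poly (p :: 'n coeffs) = 0"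
  shows "l = 0 \<and> p = 0"
proof -
  let ?n = "CARD('n)"
  have dA: "degree (A_poly \<theta>) \<le> ?n" and dB: "degree (B_poly \<theta>) \<le> ?n"
    unfolding A_poly_def B_poly_def by (auto intro!: degree_add_le degree_shift_poly)
  let ?A = "z_mult ?n (A_poly \<theta>)" and ?B = "z_mult ?n (B_poly \<theta>)"
  let ?L = "z_mult ?n (shift_poly l)" and ?P = "z_mult ?n (shift_poly p)"
  have E: "?A * ?L + ?B * ?P = 0"
    using arg_cong[OF eq, of "z_mult (?n + ?n)"] dA dB degree_shift_poly[of l] degree_shift_poly[of p]
    by (simp add: z_mult_add z_mult_mult z_mult_0)
  then have "?A dvd ?P * ?B"
    by (metis add_eq_0_iff dvd_minus_iff dvd_triv_left mult.commute minus_minus)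
  with co have dv: "?A dvd ?P" by (simp add: coprime_dvd_mult_left_iff)
  have cA: "coeff ?A ?n = 1" by (simp add: coeff_z_mult A_poly_def coeff_shift_poly_0)
  have "degree ?P < ?n"
  proof -
    have "degree ?P \<le> ?n - 1"
      by (rule degree_le) (auto simp: coeff_z_mult coeff_shift_poly_0 dest: le_antisym[of _ ?n]
          intro!: arg_cong[where f="coeff (shift_poly p)"])
    then show ?thesis using zero_less_card_finite[where 'a='n] by linarith
  qed
  moreover have "degree ?A \<ge> ?n" using cA by (intro le_degree) simp
  ultimately have P0: "?P = 0" using dvd_imp_degree_le[OF dv] by linarith
  have "?A \<noteq> 0" using cA by force
  with E P0 have L0: "?L = 0" by simp
  have "shift_poly v = 0" if "z_mult ?n (shift_poly v) = 0" for v :: "'n coeffs"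
  proof (rule poly_eqI)
    fix j
    show "coeff (shift_poly v) j = coeff 0 j"
      using arg_cong[OF that, of "\<lambda>q. coeff q (?n - j)"] degree_shift_poly[of v]
      by (cases "j \<le> ?n") (auto simp: coeff_z_mult intro: coeff_eq_0)
  qed
  with P0 L0 show ?thesis by (blast intro: shift_poly_eq_0)
qed

lemma pole_placement_gains_ex1:
  fixes \<theta> :: "'n::{finite,linorder} param"
  assumes co: "coprime (z_mult CARD('n) (A_poly \<theta>)) (z_mult CARD('n) (B_poly \<theta>))"
    and Astar: "coeff Astar 0 = 1" "degree Astar \<le> 2 * CARD('n)"
  shows "\<exists>!(l :: 'n coeffs, p :: 'n coeffs).
    A_poly \<theta> * (1 + shift_poly l) + B_poly \<theta> * shift_poly p = Astar"
proof -
  let ?n = "CARD('n)"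
  define pl where "pl = (\<lambda>x :: 'n param. A_poly \<theta> * shift_poly (\<chi> i. x $ Inl i) +
      B_poly \<theta> * shift_poly (\<chi> i. x $ Inr i))"
  define pos where "pos = (\<lambda>k :: 'n + 'n. case k of Inl i \<Rightarrow> idx i | Inr i \<Rightarrow> ?n + idx i)"
  define T where "T = (\<lambda>x. \<chi> k. coeff (pl x) (pos k))"
  have dA: "degree (A_poly \<theta>) \<le> ?n" and dB: "degree (B_poly \<theta>) \<le> ?n"
    unfolding A_poly_def B_poly_def by (auto intro!: degree_add_le degree_shift_poly)
  have deg: "degree (pl x) \<le> 2 * ?n" for x
    unfolding pl_def mult_2 using dA dB
    by (intro degree_add_le order.trans[OF degree_mult_le] add_mono degree_shift_poly)
  have pl0: "coeff (pl x) 0 = 0" for x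
    by (simp add: pl_def coeff_mult_0 coeff_shift_poly_0)
  have idx_surj: "\<exists>i :: 'n. idx i = j" if "j \<in> {1..?n}" for j
    using that unfolding bij_betw_imp_surj_on[OF bij_betw_idx, symmetric] by blast
  have pos: "\<exists>k. pos k = j" if "1 \<le> j" "j \<le> 2 * ?n" for j
  proof (cases "j \<le> ?n")
    case True
    with that have "j \<in> {1..?n}" by simp
    from idx_surj[OF this] obtain i :: 'n where "idx i = j" ..
    then have "pos (Inl i) = j" by (simp add: pos_def)
    then show ?thesis ..
  next
    case False
    with that have "j - ?n \<in> {1..?n}" by auto
    from idx_surj[OF this] obtain i :: 'n where "idx i = j - ?n" ..
    with False have "pos (Inr i) = j" by (simp add: pos_def)
    then show ?thesis ..
  qed
  have poly_eq: "q = r" if "degree q \<le> 2 * ?n" "degree r \<le> 2 * ?n" "coeff q 0 = coeff r 0"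
    "\<And>k. coeff q (pos k) = coeff r (pos k)" for q r :: "real poly"
  proof (rule poly_eqI)
    fix j
    consider "j = 0" | "1 \<le> j" "j \<le> 2 * ?n" | "j > 2 * ?n" by linarith
    then show "coeff q j = coeff r j"
    proof cases
      case 3 then show ?thesis using that by (simp add: coeff_eq_0)
    qed (use that pos in \<open>metis+\<close>)
  qed
  have pl_add: "pl (x + y) = pl x + pl y" for x y
  proof -
    have "(\<chi> i. (x + y) $ Inl i) = (\<chi> i. x $ Inl i) + (\<chi> i. y $ Inl i)"
      "(\<chi> i. (x + y) $ Inr i) = (\<chi> i. x $ Inr i) + (\<chi> i. y $ Inr i)"
      by (simp_all add: vec_eq_iff)
    then show ?thesis by (simp add: pl_def shift_poly_add algebra_simps)
  qed
  have pl_scale: "pl (c *\<^sub>R x) = smult c (pl x)" for c x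
  proof -
    have "(\<chi> i. (c *\<^sub>R x) $ Inl i) = c *\<^sub>R (\<chi> i. x $ Inl i)"
      "(\<chi> i. (c *\<^sub>R x) $ Inr i) = c *\<^sub>R (\<chi> i. x $ Inr i)"
      by (simp_all add: vec_eq_iff)
    then show ?thesis by (simp add: pl_def shift_poly_scale smult_add_right)
  qed
  have lin: "linear T"
    by (rule linearI) (simp_all add: T_def pl_add pl_scale vec_eq_iff)
  have "inj T"
  proof (subst linear_injective_0[OF lin], intro allI impI)
    fix x assume "T x = 0"
    then have "pl x = 0"
      using deg pl0 by (intro poly_eq) (simp_all add: T_def vec_eq_iff)
    then have "(\<chi> i. x $ Inl i) = (0 :: 'n coeffs) \<and> (\<chi> i. x $ Inr i) = (0 :: 'n coeffs)"
      using diophantine_inj[OF co] by (simp add: pl_def)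
    then have "x $ k = 0" for k by (cases k) (auto simp: vec_eq_iff)
    then show "x = 0" by (simp add: vec_eq_iff)
  qed
  with lin have "surj T"
    by (intro linear_injective_imp_surjective) auto
  then obtain x where x: "T x = (\<chi> k. coeff (Astar - A_poly \<theta>) (pos k))" by (metis surjD)
  have A0: "coeff (A_poly \<theta>) 0 = 1" by (simp add: A_poly_def coeff_shift_poly_0)
  have "degree (Astar - A_poly \<theta>) \<le> 2 * ?n" using Astar dA by (intro degree_diff_le) auto
  then have plx: "pl x = Astar - A_poly \<theta>"
    using deg pl0 x A0 Astar by (intro poly_eq) (simp_all add: T_def vec_eq_iff)
  define l0 p0 where "l0 = (\<chi> i. x $ Inl i)" and "p0 = (\<chi> i. x $ Inr i)"
  have sol: "A_poly \<theta> * (1 + shift_poly l0) + B_poly \<theta> * shift_poly p0 = Astar"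
    using plx by (simp add: pl_def l0_def p0_def algebra_simps)
  have shift_diff: "shift_poly (l - l') = shift_poly l - shift_poly l'" for l l' :: "'n coeffs"
    using shift_poly_add[of "l - l'" l'] by simp
  have uniq: "l = l0 \<and> p = p0"
    if eq: "A_poly \<theta> * (1 + shift_poly l) + B_poly \<theta> * shift_poly p = Astar" for l p :: "'n coeffs"
  proof -
    have "A_poly \<theta> * shift_poly (l - l0) + B_poly \<theta> * shift_poly (p - p0) =
        (A_poly \<theta> * (1 + shift_poly l) + B_poly \<theta> * shift_poly p) -
        (A_poly \<theta> * (1 + shift_poly l0) + B_poly \<theta> * shift_poly p0)"
      by (simp add: shift_diff algebra_simps)
    also have "\<dots> = 0" by (simp only: eq sol)
    finally show ?thesis using diophantine_inj[OF co] by fastforce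
  qed
  show ?thesis (is "\<exists>!lp. ?Q lp")
  proof (rule ex_ex1I)
    show "\<exists>lp. ?Q lp" using sol by (intro exI[of _ "(l0, p0)"]) simp
    fix a b assume "?Q a" "?Q b"
    then have "a = (l0, p0)" "b = (l0, p0)"
      using uniq[of "fst a" "snd a"] uniq[of "fst b" "snd b"]
      by (simp_all add: case_prod_unfold prod_eq_iff)
    then show "a = b" by simp
  qed
qed

definition L_gain :: "real poly \<Rightarrow> 'n::{finite,linorder} param \<Rightarrow> 'n coeffs"
  where "L_gain Astar \<theta> = fst (pole_placement_gains Astar \<theta>)"

definition P_gain :: "real poly \<Rightarrow> 'n::{finite,linorder} param \<Rightarrow> 'n coeffs"
  where "P_gain Astar \<theta> = snd (pole_placement_gains Astar \<theta>)"

definition filtered_reference ::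
    "real poly \<Rightarrow> (int \<Rightarrow> 'n::{finite,linorder} param) \<Rightarrow> (int \<Rightarrow> real) \<Rightarrow> int \<Rightarrow> real"
  where "filtered_reference Astar \<theta>h ystar t =
    (\<Sum>i\<in>UNIV. P_gain Astar (\<theta>h t) $ i * ystar (t + 1 - int (idx i)))"


subsection \<open>Closed loop\<close>

text \<open>
  The signals \<open>y\<close>, \<open>u\<close> and the estimate \<open>\<theta>h\<close> are constrained only at the times occurring
  in the recursion, where they are determined by the remaining arguments.
\<close>

definition closed_loop ::
    "'n::{finite,linorder} param set \<Rightarrow> real poly \<Rightarrow> ereal \<Rightarrow> int \<Rightarrow>
     'n param \<Rightarrow> 'n param \<Rightarrow> 'n param \<Rightarrow> (int \<Rightarrow> real) \<Rightarrow> (int \<Rightarrow> real) \<Rightarrow>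
     (int \<Rightarrow> real) \<Rightarrow> (int \<Rightarrow> real) \<Rightarrow> (int \<Rightarrow> 'n param) \<Rightarrow> bool"
  where "closed_loop S Astar \<delta> t0 \<theta>0 \<theta>star \<phi>0 ystar d y u \<theta>h \<longleftrightarrow>
    regressor y u t0 = \<phi>0 \<and>
    (\<forall>t\<ge>t0. y (t + 1) = regressor y u t \<bullet> \<theta>star + d t) \<and>
    \<theta>h t0 = \<theta>0 \<and>
    (\<forall>t\<ge>t0. \<theta>h (t + 1) =
      estimator_step S \<delta> (regressor y u t) (y (t + 1) - regressor y u t \<bullet> \<theta>h t) (\<theta>h t)) \<and>
    (\<forall>t\<ge>t0 + 1. u t =
      - (\<Sum>i\<in>UNIV. L_gain Astar (\<theta>h (t - 1)) $ i * u (t - int (idx i)))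
      - (\<Sum>i\<in>UNIV. P_gain Astar (\<theta>h (t - 1)) $ i *
            (y (t - int (idx i)) - ystar (t - int (idx i)))))"

end

theory Submission
  imports Defs "HOL-Computational_Algebra.Fundamental_Theorem_Algebra"
begin

text \<open>
  With a frozen estimate \<open>\<theta>\<close> the loop is a linear map \<open>F \<theta>\<close> under which both \<open>y\<close> and \<open>u\<close> obey the
  scalar recurrence with characteristic polynomial \<open>z\<^sup>2\<^sup>n A\<^sup>*(z\<^sup>-\<^sup>1)\<close>, whatever \<open>\<theta> \<in> S\<close> is. Hence the
  powers of \<open>F \<theta>\<close> decay uniformly on \<open>S\<close>, and there are norms \<open>V \<theta>\<close>, Lipschitz in \<open>\<theta>\<close>, with
  \<open>V \<theta> (F \<theta> x) \<le> \<mu> V \<theta> x\<close> and \<open>\<mu> < \<lambda>\<close>. The true loop is \<open>\<phi>(t+1) = F (\<theta>(t)) \<phi>(t)\<close> plus the inputs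
  \<open>e(t+1)\<close> and \<open>r(t)\<close>. Put \<open>W = V \<theta> \<phi> exp (2 H \<parallel>\<theta> - \<theta>\<^sup>*\<parallel>\<^sup>2)\<close>.

  If \<open>\<bar>d\<bar> < \<nu> \<parallel>\<phi>\<parallel>\<close> with \<open>\<nu>\<close> small, then \<open>x = \<bar>e\<bar> / \<parallel>\<phi>\<parallel>\<close> bounds both the perturbation of \<open>F \<theta>\<close> and
  the change of the estimate, so \<open>V\<close> grows at most by \<open>\<mu> exp (K x) \<le> \<mu> exp (\<epsilon> + H x\<^sup>2)\<close>, and \<open>H x\<^sup>2\<close> is
  absorbed by the decrease of the parameter error. Otherwise \<open>\<parallel>\<phi>\<parallel> \<le> \<bar>d\<bar> / \<nu>\<close>, and the next regressor
  is bounded by \<open>\<bar>d\<bar> + \<bar>r\<bar>\<close>. In both cases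
  \<open>W(t+1) \<le> \<lambda> W(t) + c (\<bar>r(t)\<bar> + \<bar>d(t)\<bar>)\<close>, which unrolls to the claim.
\<close>

subsection \<open>Scalar recurrences\<close>

text \<open>\<open>shift_op p w\<close> is the polynomial \<open>p\<close> in the forward shift
  applied to the sequence \<open>w\<close>. Working forward keeps all indices natural
  numbers.\<close>

definition shift_op :: "'a::comm_ring_1 poly \<Rightarrow> (nat \<Rightarrow> 'a) \<Rightarrow> nat \<Rightarrow> 'a"
  where "shift_op p w k = (\<Sum>i\<le>degree p. coeff p i * w (k + i))"

lemma shift_op_altdef:
  "degree p \<le> N \<Longrightarrow> shift_op p w k = (\<Sum>i\<le>N. coeff p i * w (k + i))"
  unfolding shift_op_def by (rule sum.mono_neutral_left) (auto simp: coeff_eq_0)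

lemma shift_op_0 [simp]: "shift_op 0 w k = 0"
  by (simp add: shift_op_def)

lemma shift_op_pCons: "shift_op (pCons a p) w k = a * w k + shift_op p w (Suc k)"
proof -
  have "degree (pCons a p) \<le> Suc (degree p)" by (simp add: degree_pCons_eq_if)
  then show ?thesis
    by (simp only: shift_op_altdef sum.atMost_Suc_shift) (simp add: shift_op_def)
qed

lemma shift_op_add: "shift_op (p + q) w k = shift_op p w k + shift_op q w k"
proof -
  let ?N = "max (degree p) (degree q)"
  have "degree (p + q) \<le> ?N" by (intro degree_add_le) auto
  then show ?thesis
    by (simp add: shift_op_altdef[of _ ?N] sum.distrib algebra_simps)
qed

lemma shift_op_smult: "shift_op (smult c p) w k = c * shift_op p w k"
  unfolding shift_op_altdef[OF degree_smult_le] unfolding shift_op_def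
  by (simp add: sum_distrib_left mult.assoc)

text \<open>Sequences become a module over the polynomial ring. This lets linear factors be split
  off one root at a time, and lets one signal be eliminated from two coupled recurrences.\<close>

lemma shift_op_mult: "shift_op (p * q) w k = shift_op p (shift_op q w) k"
  by (induction p arbitrary: k)
    (simp_all add: shift_op_pCons shift_op_add shift_op_smult mult_pCons_left)

lemma shift_op_uminus_right: "shift_op p (\<lambda>k. - w k) k = - shift_op p w k"
  by (simp add: shift_op_def sum_negf)

lemma shift_op_of_real:
  "shift_op (map_poly complex_of_real p) (\<lambda>k. of_real (w k)) k = of_real (shift_op p w k)"
  by (simp add: shift_op_def coeff_map_poly degree_map_poly)

lemma shift_op_z_mult: "shift_op (z_mult m p) w k = (\<Sum>i\<le>m. coeff p i * w (k + m - i))"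
proof -
  have "degree (z_mult m p) \<le> m" by (rule degree_le) (simp add: coeff_z_mult)
  then have "shift_op (z_mult m p) w k = (\<Sum>i\<le>m. coeff p (m - i) * w (k + i))"
    by (simp add: shift_op_altdef coeff_z_mult)
  also have "\<dots> = (\<Sum>i\<le>m. coeff p i * w (k + m - i))"
    by (rule sum.reindex_bij_witness[of _ "\<lambda>i. m - i" "\<lambda>i. m - i"]) auto
  finally show ?thesis .
qed

lemma coeff_shift_poly: "coeff (shift_poly v) j = (\<Sum>i\<in>UNIV. if idx i = j then v $ i else 0)"
  by (simp add: shift_poly_def coeff_sum)

lemma shift_op_shift_poly:
  fixes v :: "'n::{finite,linorder} coeffs"
  shows "shift_op (z_mult CARD('n) (shift_poly v)) w k =
    (\<Sum>i\<in>UNIV. v $ i * w (k + CARD('n) - idx i))"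
proof -
  have "shift_op (z_mult CARD('n) (shift_poly v)) w k =
      (\<Sum>j\<le>CARD('n). \<Sum>i\<in>UNIV. if idx i = j then v $ i * w (k + CARD('n) - j) else 0)"
    by (simp add: shift_op_z_mult coeff_shift_poly sum_distrib_right if_distrib[where f="\<lambda>a. a * _"]
        cong: if_cong)
  also have "\<dots> = (\<Sum>i\<in>UNIV. \<Sum>j\<le>CARD('n). if idx i = j then v $ i * w (k + CARD('n) - j) else 0)"
    by (rule sum.swap)
  finally show ?thesis by (simp add: idx_bounds)
qed

lemma shift_op_1_plus_shift_poly:
  fixes v :: "'n::{finite,linorder} coeffs"
  shows "shift_op (z_mult CARD('n) (1 + shift_poly v)) w k =
    w (k + CARD('n)) + (\<Sum>i\<in>UNIV. v $ i * w (k + CARD('n) - idx i))"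
  unfolding z_mult_add shift_op_add shift_op_shift_poly
  by (simp add: shift_op_z_mult coeff_1 if_distrib[where f="\<lambda>a. a * _"] cong: if_cong)

text \<open>Induction on the degree. For a root \<open>r\<close> of
  \<open>Q = [:-r, 1:] * Q'\<close>, the sequence \<open>v = w(k+1) - r w(k)\<close> falls under the
  induction hypothesis for \<open>Q'\<close>, and \<open>w\<close> is recovered from the first-order
  recurrence with forcing \<open>v\<close>. As \<open>norm r < \<mu>\<close> strictly, multiple
  roots cause no polynomial factors.\<close>

lemma shift_op_decay:
  fixes Q :: "complex poly"
  assumes "Q \<noteq> 0" and "\<And>z. poly Q z = 0 \<Longrightarrow> norm z < \<mu>" and "0 < \<mu>"
  shows "\<exists>C\<ge>0. \<forall>w K. 0 \<le> K \<longrightarrow> (\<forall>j<degree Q. norm (w j) \<le> K * \<mu> ^ j) \<longrightarrow>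
    (\<forall>t. norm (shift_op Q w t) \<le> K * \<mu> ^ t) \<longrightarrow> (\<forall>t. norm (w t) \<le> C * K * \<mu> ^ t)"
  using assms(1,2)
proof (induction "degree Q" arbitrary: Q)
  case 0
  then obtain c where Q: "Q = [:c:]" "c \<noteq> 0" by (metis degree_eq_zeroE pCons_0_0)
  show ?case
  proof (intro exI[of _ "inverse (norm c)"] conjI allI impI)
    fix w K t assume "\<forall>t. norm (shift_op Q w t) \<le> K * \<mu> ^ t"
    then have "norm c * norm (w t) \<le> K * \<mu> ^ t" by (simp add: Q shift_op_def norm_mult)
    then show "norm (w t) \<le> inverse (norm c) * K * \<mu> ^ t"
      using Q by (simp add: field_simps)
  qed simp
next
  case (Suc n)
  obtain r where r: "poly Q r = 0"
    using Suc.hyps(2) fundamental_theorem_of_algebra[of Q] by (auto simp: constant_degree)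
  then obtain Q' where Q': "Q = [:-r, 1:] * Q'" by (metis dvd_def poly_eq_0_iff_dvd)
  have "Q' \<noteq> 0" using Suc.prems(1) Q' by auto
  then have deg: "degree Q = Suc (degree Q')"
    unfolding Q' by (subst degree_mult_eq) auto
  have "norm z < \<mu>" if "poly Q' z = 0" for z using Suc.prems(2) that by (simp add: Q')
  with Suc.hyps deg \<open>Q' \<noteq> 0\<close> obtain C where C: "C \<ge> 0"
    "\<And>w K t. \<lbrakk>0 \<le> K; \<forall>j<degree Q'. norm (w j) \<le> K * \<mu> ^ j; \<forall>t. norm (shift_op Q' w t) \<le> K * \<mu> ^ t\<rbrakk>
      \<Longrightarrow> norm (w t) \<le> C * K * \<mu> ^ t"
    by (metis old.nat.inject)
  have rmu: "norm r < \<mu>" using Suc.prems(2) r by blast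
  \<comment> \<open>\<open>D\<close> is the decay constant of \<open>v\<close>, whose initial values
    are bounded with \<open>2 * \<mu>\<close> in place of 1. \<open>E\<close> solves
    \<open>norm r * E + D \<le> E * \<mu>\<close>, which closes the induction on \<open>t\<close>;
    its summand 1 covers \<open>t = 0\<close>.\<close>
  define D where "D = C * (1 + 2 * \<mu>)"
  define E where "E = 1 + D / (\<mu> - norm r)"
  have D0: "D \<ge> 0" using C(1) \<open>0 < \<mu>\<close> by (simp add: D_def)
  have ED: "norm r * E + D \<le> E * \<mu>"
  proof -
    have "E * (\<mu> - norm r) = \<mu> - norm r + D" using rmu by (simp add: E_def distrib_right)
    with rmu show ?thesis by (simp add: algebra_simps)
  qed
  have E1: "E \<ge> 1" using D0 rmu by (simp add: E_def)
  show ?case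
  proof (intro exI[of _ E] conjI allI impI)
    fix w K t
    assume K: "0 \<le> (K::real)" and ini: "\<forall>j<degree Q. norm (w j) \<le> K * \<mu> ^ j"
      and op: "\<forall>t. norm (shift_op Q w t) \<le> K * \<mu> ^ t"
    define v where "v = shift_op [:-r, 1:] w"
    have v: "v k = w (Suc k) - r * w k" for k by (simp add: v_def shift_op_pCons)
    have "norm (v k) \<le> C * ((1 + 2 * \<mu>) * K) * \<mu> ^ k" for k
    proof (rule C(2))
      show "0 \<le> (1 + 2 * \<mu>) * K" using K \<open>0 < \<mu>\<close> by simp
      show "\<forall>j<degree Q'. norm (v j) \<le> (1 + 2 * \<mu>) * K * \<mu> ^ j"
      proof (intro allI impI)
        fix j assume j: "j < degree Q'"
        have "norm (v j) \<le> norm (w (Suc j)) + norm r * norm (w j)"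
          unfolding v by (metis norm_mult norm_triangle_ineq4)
        also have "\<dots> \<le> K * \<mu> ^ Suc j + \<mu> * (K * \<mu> ^ j)"
          using ini j deg rmu \<open>0 < \<mu>\<close> K by (intro add_mono mult_mono) auto
        also have "\<dots> \<le> (1 + 2 * \<mu>) * K * \<mu> ^ j" using K \<open>0 < \<mu>\<close> by (simp add: algebra_simps)
        finally show "norm (v j) \<le> (1 + 2 * \<mu>) * K * \<mu> ^ j" .
      qed
      show "\<forall>t. norm (shift_op Q' v t) \<le> (1 + 2 * \<mu>) * K * \<mu> ^ t"
      proof
        fix t
        have "norm (shift_op Q' v t) \<le> K * \<mu> ^ t"
          using op unfolding Q' v_def shift_op_mult[symmetric] by (simp add: mult.commute)
        also have "\<dots> \<le> (1 + 2 * \<mu>) * K * \<mu> ^ t" using K \<open>0 < \<mu>\<close> by (simp add: algebra_simps)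
        finally show "norm (shift_op Q' v t) \<le> (1 + 2 * \<mu>) * K * \<mu> ^ t" .
      qed
    qed
    then have vb: "norm (v k) \<le> D * K * \<mu> ^ k" for k by (simp add: D_def mult.assoc)
    show "norm (w t) \<le> E * K * \<mu> ^ t"
    proof (induction t)
      case 0
      have "norm (w 0) \<le> 1 * K" using ini deg by auto
      also have "\<dots> \<le> E * K" using E1 K by (intro mult_right_mono)
      finally show ?case by simp
    next
      case (Suc t)
      have "w (Suc t) = r * w t + v t" by (simp add: v)
      then have "norm (w (Suc t)) \<le> norm r * norm (w t) + norm (v t)"
        by (metis norm_mult norm_triangle_ineq)
      also have "\<dots> \<le> norm r * (E * K * \<mu> ^ t) + D * K * \<mu> ^ t"
        by (intro add_mono mult_left_mono Suc vb) auto
      also have "\<dots> = (norm r * E + D) * (K * \<mu> ^ t)" by (simp add: algebra_simps)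
      also have "\<dots> \<le> (E * \<mu>) * (K * \<mu> ^ t)" using ED K \<open>0 < \<mu>\<close> by (intro mult_right_mono) auto
      finally show ?case by (simp add: algebra_simps)
    qed
  qed (use E1 in simp)
qed

text \<open>The complex estimate is applied to a real sequence. Since
  \<open>coeff Astar 0 = 1\<close>, \<open>z_mult m Astar\<close> has degree exactly
  \<open>m\<close>, so bounds on the first \<open>m\<close> values suffice. It also has a root,
  whose modulus lies below \<open>\<mu>\<close>; hence \<open>\<mu>\<close> is positive.\<close>

lemma target_decay:
  assumes st: "stable_target m Astar" and m: "0 < m" and mu: "max_root_modulus m Astar < \<mu>" and mu1: "\<mu> \<le> 1"
  shows "0 < \<mu>" and "\<exists>C\<ge>0. \<forall>w::nat \<Rightarrow> real. \<forall>K. (\<forall>j<m. \<bar>w j\<bar> \<le> K) \<longrightarrow>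
    (\<forall>t. shift_op (z_mult m Astar) w t = 0) \<longrightarrow> (\<forall>t. \<bar>w t\<bar> \<le> C * K * \<mu> ^ t)"
proof -
  define Q where "Q = map_poly complex_of_real (z_mult m Astar)"
  have "coeff (z_mult m Astar) m = 1" using st by (simp add: coeff_z_mult stable_target_def)
  then have cQ: "coeff Q m = 1" by (simp add: Q_def coeff_map_poly)
  have "degree (z_mult m Astar) \<le> m" by (rule degree_le) (simp add: coeff_z_mult)
  then have dQ: "degree Q = m"
    using cQ by (intro antisym le_degree) (auto simp: Q_def degree_map_poly)
  have Q0: "Q \<noteq> 0" using cQ by auto
  have zr: "z_roots m Astar = {z. poly Q z = 0}" by (simp add: z_roots_def Q_def)
  have fin: "finite (z_roots m Astar)" unfolding zr by (rule poly_roots_finite[OF Q0])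
  have root: "norm z < \<mu>" if "poly Q z = 0" for z
  proof -
    have "norm z \<le> max_root_modulus m Astar"
      unfolding max_root_modulus_def using fin that by (intro Max_ge) (auto simp: zr)
    with mu show ?thesis by simp
  qed
  obtain z where "poly Q z = 0"
    using fundamental_theorem_of_algebra[of Q] dQ m by (auto simp: constant_degree)
  from root[OF this] show mu0: "0 < \<mu>" by (meson norm_ge_zero order_le_less_trans)
  from shift_op_decay[OF Q0 root mu0] obtain C where C: "C \<ge> 0"
    "\<And>w K t. \<lbrakk>0 \<le> K; \<forall>j<m. norm (w j) \<le> K * \<mu> ^ j; \<forall>t. norm (shift_op Q w t) \<le> K * \<mu> ^ t\<rbrakk>
      \<Longrightarrow> norm (w t) \<le> C * K * \<mu> ^ t"
    unfolding dQ by blast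
  show "\<exists>C\<ge>0. \<forall>w::nat \<Rightarrow> real. \<forall>K. (\<forall>j<m. \<bar>w j\<bar> \<le> K) \<longrightarrow>
    (\<forall>t. shift_op (z_mult m Astar) w t = 0) \<longrightarrow> (\<forall>t. \<bar>w t\<bar> \<le> C * K * \<mu> ^ t)"
  \<comment> \<open>Dividing by \<open>\<mu> ^ m\<close> turns the constant bound on the first
    \<open>m\<close> values into one proportional to \<open>\<mu> ^ j\<close>, because
    \<open>\<mu> ^ m \<le> \<mu> ^ j\<close> for \<open>j < m\<close>.\<close>
  proof (intro exI[of _ "C / \<mu> ^ m"] conjI allI impI)
    fix w :: "nat \<Rightarrow> real" and K t
    assume ini: "\<forall>j<m. \<bar>w j\<bar> \<le> K" and op: "\<forall>t. shift_op (z_mult m Astar) w t = 0"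
    have K: "K \<ge> 0" using ini m by force
    have "norm (complex_of_real (w t)) \<le> C * (K / \<mu> ^ m) * \<mu> ^ t"
    proof (rule C(2))
      show "0 \<le> K / \<mu> ^ m" using K mu0 by simp
      show "\<forall>j<m. norm (complex_of_real (w j)) \<le> K / \<mu> ^ m * \<mu> ^ j"
      proof (intro allI impI)
        fix j assume j: "j < m"
        then have "\<mu> ^ m \<le> \<mu> ^ j" using mu0 mu1 by (intro power_decreasing) auto
        then have "K * \<mu> ^ m \<le> K * \<mu> ^ j" using K by (intro mult_left_mono)
        then have "K \<le> K / \<mu> ^ m * \<mu> ^ j" using mu0 by (simp add: field_simps)
        with ini j show "norm (complex_of_real (w j)) \<le> K / \<mu> ^ m * \<mu> ^ j" by force
      qed
      show "\<forall>t. norm (shift_op Q (\<lambda>j. complex_of_real (w j)) t) \<le> K / \<mu> ^ m * \<mu> ^ t"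
        using op K mu0 by (simp add: Q_def shift_op_of_real)
    qed
    then show "\<bar>w t\<bar> \<le> C / \<mu> ^ m * K * \<mu> ^ t" by simp
  qed (use C mu0 in simp)
qed


subsection \<open>The pole placement gains are Lipschitz on the parameter set\<close>

lemma shift_poly_diff: "shift_poly (v - w) = shift_poly v - shift_poly w"
  using shift_poly_add[of "v - w" w] by simp

lemma abs_coeff_shift_poly_le:
  assumes "\<And>i. \<bar>v $ i\<bar> \<le> b" "0 \<le> b"
  shows "\<bar>coeff (shift_poly v) j\<bar> \<le> b"
proof (cases "\<exists>i. idx i = j \<and> v $ i \<noteq> 0")
  case True
  then show ?thesis using assms coeff_shift_poly_idx by metis
next
  case False
  then have "coeff (shift_poly v) j = 0"
    unfolding coeff_shift_poly by (intro sum.neutral) auto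
  with assms show ?thesis by simp
qed

lemma abs_coeff_mult_le:
  fixes p q :: "real poly"
  assumes "\<And>i. \<bar>coeff p i\<bar> \<le> a" "\<And>i. \<bar>coeff q i\<bar> \<le> b"
  shows "\<bar>coeff (p * q) j\<bar> \<le> real (Suc j) * (a * b)"
proof -
  have "a \<ge> 0" using assms(1)[of 0] by linarith
  then have "\<bar>coeff (p * q) j\<bar> \<le> (\<Sum>i\<le>j. a * b)"
    unfolding coeff_mult using assms
    by (intro order.trans[OF sum_abs] sum_mono) (auto simp: abs_mult intro!: mult_mono)
  then show ?thesis by simp
qed

lemma A_poly_diff: "A_poly \<theta> - A_poly \<theta>' = shift_poly (\<chi> i. - ((\<theta> - \<theta>') $ Inl i))"
proof -
  have "(\<chi> i. - ((\<theta> - \<theta>') $ Inl i)) = (\<chi> i. - (\<theta> $ Inl i)) - (\<chi> i. - (\<theta>' $ Inl i))"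
    by (simp add: vec_eq_iff)
  then show ?thesis by (simp add: A_poly_def shift_poly_diff)
qed

lemma B_poly_diff: "B_poly \<theta> - B_poly \<theta>' = shift_poly (\<chi> i. (\<theta> - \<theta>') $ Inr i)"
proof -
  have "(\<chi> i. (\<theta> - \<theta>') $ Inr i) = (\<chi> i. \<theta> $ Inr i) - (\<chi> i. \<theta>' $ Inr i)"
    by (simp add: vec_eq_iff)
  then show ?thesis by (simp add: B_poly_def shift_poly_diff)
qed

lemma degree_A_poly: "degree (A_poly (\<theta> :: 'n::{finite,linorder} param)) \<le> CARD('n)"
  unfolding A_poly_def by (intro degree_add_le degree_shift_poly) simp

lemma degree_B_poly: "degree (B_poly (\<theta> :: 'n::{finite,linorder} param)) \<le> CARD('n)"
  unfolding B_poly_def by (rule degree_shift_poly)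

lemma pole_placement_identity:
  fixes S :: "'n::{finite,linorder} param set"
  assumes "admissible_params S" "stable_target (2 * CARD('n)) Astar" "\<theta> \<in> S"
  shows "A_poly \<theta> * (1 + shift_poly (L_gain Astar \<theta>)) + B_poly \<theta> * shift_poly (P_gain Astar \<theta>) = Astar"
proof -
  have "\<exists>!(l :: 'n coeffs, p :: 'n coeffs).
      A_poly \<theta> * (1 + shift_poly l) + B_poly \<theta> * shift_poly p = Astar"
    using assms by (intro pole_placement_gains_ex1) (auto simp: admissible_params_def stable_target_def)
  from theI'[OF this] show ?thesis
    by (simp add: L_gain_def P_gain_def pole_placement_gains_def case_prod_unfold)
qed

text \<open>The linear part of the pole placement equation in the unknown gains; the Sylvester
  matrix as a polynomial-valued map.\<close>

definition sylvester :: "'n::{finite,linorder} param \<Rightarrow> 'n coeffs \<times> 'n coeffs \<Rightarrow> real poly"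
  where "sylvester \<theta> z = A_poly \<theta> * shift_poly (fst z) + B_poly \<theta> * shift_poly (snd z)"

lemma degree_sylvester: "degree (sylvester (\<theta> :: 'n::{finite,linorder} param) z) \<le> 2 * CARD('n)"
  unfolding sylvester_def mult_2
  by (intro degree_add_le order.trans[OF degree_mult_le] add_mono degree_shift_poly
      degree_A_poly degree_B_poly)

lemma sylvester_scaleR: "sylvester \<theta> (c *\<^sub>R z) = smult c (sylvester \<theta> z)"
  by (simp add: sylvester_def shift_poly_scale smult_add_right)

text \<open>The coefficient sum is continuous on the compact set \<open>S\<close> times the unit
  sphere and has no zero there, by coprimality (\<open>diophantine_inj\<close>). Its minimum is
  therefore positive, and homogeneity extends the bound to all \<open>z\<close>. This is a uniform
  bound on the inverse of the Sylvester map.\<close>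

lemma sylvester_lower_bound:
  fixes S :: "'n::{finite,linorder} param set"
  assumes adm: "admissible_params S"
  shows "\<exists>c>0. \<forall>\<theta>\<in>S. \<forall>z. c * norm z \<le> (\<Sum>j\<le>2 * CARD('n). \<bar>coeff (sylvester \<theta> z) j\<bar>)"
proof -
  define N where "N = (\<lambda>x :: 'n param \<times> 'n coeffs \<times> 'n coeffs.
    \<Sum>j\<le>2 * CARD('n). \<bar>coeff (sylvester (fst x) (snd x)) j\<bar>)"
  let ?K = "S \<times> sphere (0 :: 'n coeffs \<times> 'n coeffs) 1"
  \<comment> \<open>After unfolding, coefficients are sums of conditionals whose conditions do not
    depend on the point, so each conditional is continuous.\<close>
  have continuous_if: "continuous_on ?K (\<lambda>x. if P then f x else 0)"
    if "continuous_on ?K f" for P and f :: "_ \<Rightarrow> real"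
    using that by (cases P) auto
  have "compact ?K" using adm by (intro compact_Times) (auto simp: admissible_params_def)
  moreover have "?K \<noteq> {}"
    using adm vector_choose_size[of 1, where 'a = "'n coeffs \<times> 'n coeffs"]
    by (auto simp: admissible_params_def)
  moreover have "continuous_on ?K N"
    unfolding N_def sylvester_def A_poly_def B_poly_def coeff_add coeff_mult coeff_shift_poly
      vec_lambda_beta if_distrib[where f="\<lambda>a. a $ _"]
    by (intro continuous_intros) (rule continuous_if, intro continuous_intros)+
  ultimately obtain x where x: "x \<in> ?K" "\<And>y. y \<in> ?K \<Longrightarrow> N x \<le> N y"
    using continuous_attains_inf by metis
  have "N x > 0"
  proof (rule ccontr)
    assume "\<not> N x > 0"
    moreover have "N x \<ge> 0" by (simp add: N_def sum_nonneg)
    ultimately have "N x = 0" by simp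
    then have "\<forall>j\<le>2 * CARD('n). coeff (sylvester (fst x) (snd x)) j = 0"
      by (simp add: N_def sum_nonneg_eq_0_iff)
    moreover have "coeff (sylvester (fst x) (snd x)) j = 0" if "j > 2 * CARD('n)" for j
      using degree_sylvester[of "fst x" "snd x"] that by (intro coeff_eq_0) simp
    ultimately have "sylvester (fst x) (snd x) = 0"
      by (intro poly_eqI) (use not_le in auto)
    then have "fst (snd x) = 0 \<and> snd (snd x) = 0"
      using adm x(1) unfolding sylvester_def
      by (intro diophantine_inj[of "fst x"]) (auto simp: admissible_params_def)
    with x(1) show False by (auto simp: prod_eq_iff)
  qed
  moreover have "N x * norm z \<le> (\<Sum>j\<le>2 * CARD('n). \<bar>coeff (sylvester \<theta> z) j\<bar>)"
    if \<theta>: "\<theta> \<in> S" for \<theta> z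
  proof (cases "z = 0")
    case False
    have "N x \<le> N (\<theta>, (1 / norm z) *\<^sub>R z)" using \<theta> False by (intro x(2)) auto
    also have "\<dots> = (\<Sum>j\<le>2 * CARD('n). \<bar>coeff (sylvester \<theta> z) j\<bar>) / norm z"
      by (simp add: N_def sylvester_scaleR abs_mult sum_divide_distrib)
    finally show ?thesis using False by (simp add: field_simps)
  qed (simp add: sum_nonneg)
  ultimately show ?thesis by blast
qed

text \<open>The gains invert the Sylvester map, so \<open>sylvester_lower_bound\<close> reduces both
  claims to bounds on right-hand sides: \<open>Astar - A_poly \<theta>\<close> for the size, and an
  expression linear in the parameter difference for the Lipschitz estimate.\<close>

lemma gains_lipschitz:
  fixes S :: "'n::{finite,linorder} param set"
  assumes adm: "admissible_params S" and st: "stable_target (2 * CARD('n)) Astar"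
  shows "\<exists>R\<ge>0. \<exists>L\<ge>0.
    (\<forall>\<theta>\<in>S. norm (L_gain Astar \<theta>, P_gain Astar \<theta>) \<le> R) \<and>
    (\<forall>\<theta>\<in>S. \<forall>\<theta>'\<in>S. norm ((L_gain Astar \<theta>, P_gain Astar \<theta>) - (L_gain Astar \<theta>', P_gain Astar \<theta>'))
      \<le> L * norm (\<theta> - \<theta>'))"
proof -
  let ?m = "2 * CARD('n)"
  define g where "g \<theta> = (L_gain Astar \<theta>, P_gain Astar \<theta>)" for \<theta> :: "'n param"
  obtain c where c: "c > 0"
    "\<And>\<theta> z. \<theta> \<in> S \<Longrightarrow> c * norm z \<le> (\<Sum>j\<le>?m. \<bar>coeff (sylvester \<theta> z) j\<bar>)"
    using sylvester_lower_bound[OF adm] by blast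
  obtain s where s: "s \<ge> 0" "\<And>\<theta>. \<theta> \<in> S \<Longrightarrow> norm \<theta> \<le> s"
  proof -
    have "bounded S" using adm by (simp add: admissible_params_def compact_imp_bounded)
    then show ?thesis using that by (metis bounded_pos order_less_imp_le)
  qed
  have sg: "sylvester \<theta> (g \<theta>) = Astar - A_poly \<theta>" if "\<theta> \<in> S" for \<theta>
    using pole_placement_identity[OF adm st that] by (simp add: g_def sylvester_def algebra_simps)
  define \<alpha> where "\<alpha> = (\<Sum>j\<le>?m. \<bar>coeff Astar j\<bar>)"
  define R where "R = real (Suc ?m) * (\<alpha> + 1 + s) / c"
  have R0: "R \<ge> 0" using s(1) c(1) by (simp add: R_def \<alpha>_def sum_nonneg)
  have R: "norm (g \<theta>) \<le> R" if \<theta>: "\<theta> \<in> S" for \<theta>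
  proof -
    have "\<bar>coeff (Astar - A_poly \<theta>) j\<bar> \<le> \<alpha> + 1 + s" if "j \<le> ?m" for j
    proof -
      have "\<bar>coeff Astar j\<bar> \<le> \<alpha>"
        unfolding \<alpha>_def using that by (intro member_le_sum) auto
      moreover have "\<bar>coeff 1 j :: real\<bar> \<le> 1" by (simp add: coeff_1)
      moreover have "\<bar>coeff (shift_poly (\<chi> i. - (\<theta> $ Inl i))) j\<bar> \<le> s"
        using s(2)[OF \<theta>] by (intro abs_coeff_shift_poly_le s(1))
          (auto intro: order.trans[OF component_le_norm_cart])
      ultimately show ?thesis unfolding A_poly_def coeff_diff coeff_add by linarith
    qed
    then have "(\<Sum>j\<le>?m. \<bar>coeff (sylvester \<theta> (g \<theta>)) j\<bar>) \<le> (\<Sum>j\<le>?m. \<alpha> + 1 + s)"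
      unfolding sg[OF \<theta>] by (intro sum_mono) auto
    with c(2)[OF \<theta>, of "g \<theta>"] have "c * norm (g \<theta>) \<le> real (Suc ?m) * (\<alpha> + 1 + s)" by simp
    with c(1) show ?thesis by (simp add: R_def field_simps)
  qed
  define L where "L = real (Suc ?m) * (1 + real (Suc ?m) * (R + R)) / c"
  have "norm (g \<theta> - g \<theta>') \<le> L * norm (\<theta> - \<theta>')" if \<theta>: "\<theta> \<in> S" "\<theta>' \<in> S" for \<theta> \<theta>'
  proof -
    let ?d = "norm (\<theta> - \<theta>')"
    let ?DA = "A_poly \<theta> - A_poly \<theta>'" and ?DB = "B_poly \<theta> - B_poly \<theta>'"
    let ?l = "shift_poly (fst (g \<theta>'))" and ?p = "shift_poly (snd (g \<theta>'))"
    \<comment> \<open>A resolvent-type identity: inserting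
      \<open>sylvester \<theta>' (g \<theta>')\<close> leaves only differences of
      \<open>A_poly\<close> and \<open>B_poly\<close>, multiplied by bounded gains.\<close>
    have "sylvester \<theta> (g \<theta> - g \<theta>') = sylvester \<theta> (g \<theta>) - sylvester \<theta> (g \<theta>')"
      by (simp add: sylvester_def shift_poly_diff algebra_simps)
    also have "\<dots> = (sylvester \<theta> (g \<theta>) - sylvester \<theta>' (g \<theta>')) - (?DA * ?l + ?DB * ?p)"
      by (simp add: sylvester_def algebra_simps)
    finally have eq: "sylvester \<theta> (g \<theta> - g \<theta>') = - ?DA - ?DA * ?l - ?DB * ?p"
      by (simp add: sg \<theta>)
    have DA: "\<bar>coeff ?DA j\<bar> \<le> ?d" for j
      unfolding A_poly_diff
      by (rule abs_coeff_shift_poly_le)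
        (simp_all add: component_le_norm_cart del: vector_minus_component)
    have DB: "\<bar>coeff ?DB j\<bar> \<le> ?d" for j
      unfolding B_poly_diff
      by (rule abs_coeff_shift_poly_le)
        (simp_all add: component_le_norm_cart del: vector_minus_component)
    have nl: "norm (fst (g \<theta>')) \<le> R" and np: "norm (snd (g \<theta>')) \<le> R"
      using R[OF \<theta>(2)] norm_fst_le[of "fst (g \<theta>')" "snd (g \<theta>')"] norm_snd_le[of "snd (g \<theta>')" "fst (g \<theta>')"]
      by simp_all
    have l: "\<bar>coeff ?l j\<bar> \<le> R" for j
      using nl R0 by (intro abs_coeff_shift_poly_le) (auto intro: order.trans[OF component_le_norm_cart])
    have p: "\<bar>coeff ?p j\<bar> \<le> R" for j
      using np R0 by (intro abs_coeff_shift_poly_le) (auto intro: order.trans[OF component_le_norm_cart])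
    have "\<bar>coeff (sylvester \<theta> (g \<theta> - g \<theta>')) j\<bar> \<le> (1 + real (Suc ?m) * (R + R)) * ?d" if "j \<le> ?m" for j
    proof -
      have j: "real (Suc j) * (?d * R) \<le> real (Suc ?m) * (?d * R)"
        using that R0 by (intro mult_right_mono) auto
      have "\<bar>coeff (?DA * ?l) j\<bar> \<le> real (Suc j) * (?d * R)"
        by (rule abs_coeff_mult_le[OF DA l])
      moreover have "\<bar>coeff (- P - Q - Q') j\<bar> \<le> \<bar>coeff P j\<bar> + \<bar>coeff Q j\<bar> + \<bar>coeff Q' j\<bar>"
        for P Q Q' :: "real poly" by simp
      moreover note DA[of j] j
      moreover have "\<bar>coeff (?DB * ?p) j\<bar> \<le> real (Suc j) * (?d * R)"
        by (rule abs_coeff_mult_le[OF DB p])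
      ultimately have "\<bar>coeff (sylvester \<theta> (g \<theta> - g \<theta>')) j\<bar>
          \<le> ?d + real (Suc ?m) * (?d * R) + real (Suc ?m) * (?d * R)"
        unfolding eq by (meson add_mono order.trans)
      then show ?thesis by (simp add: algebra_simps)
    qed
    then have "(\<Sum>j\<le>?m. \<bar>coeff (sylvester \<theta> (g \<theta> - g \<theta>')) j\<bar>)
        \<le> (\<Sum>j\<le>?m. (1 + real (Suc ?m) * (R + R)) * ?d)"
      by (intro sum_mono) auto
    with c(2)[OF \<theta>(1), of "g \<theta> - g \<theta>'"]
    have "c * norm (g \<theta> - g \<theta>') \<le> real (Suc ?m) * (1 + real (Suc ?m) * (R + R)) * ?d"
      by (simp add: algebra_simps)
    then show ?thesis using c(1) by (simp add: L_def pos_le_divide_eq mult.commute)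
  qed
  moreover have "L \<ge> 0" using R0 c(1) by (simp add: L_def)
  ultimately show ?thesis using R R0 unfolding g_def by blast
qed


subsection \<open>The frozen closed loop\<close>

definition nth_idx :: "nat \<Rightarrow> 'n::{finite,linorder}"
  where "nth_idx j = inv_into UNIV idx j"

lemma nth_idx_idx [simp]: "nth_idx (idx i) = i"
  by (simp add: nth_idx_def inj_idx inj_def)

lemma idx_nth_idx:
  assumes "1 \<le> j" "j \<le> CARD('n)"
  shows "idx (nth_idx j :: 'n::{finite,linorder}) = j"
proof -
  have "j \<in> idx ` (UNIV :: 'n set)" using bij_betw_idx[where 'n='n] assms by (auto simp: bij_betw_def)
  then show ?thesis unfolding nth_idx_def by (rule f_inv_into_f)
qed

lemma sum_UNIV_sum:
  fixes f :: "'a::finite + 'b::finite \<Rightarrow> 'c::comm_monoid_add"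
  shows "sum f UNIV = (\<Sum>i\<in>UNIV. f (Inl i)) + (\<Sum>i\<in>UNIV. f (Inr i))"
  using sum.Plus[of UNIV UNIV f] by (simp add: comp_def)

text \<open>Jointly linear in \<open>(a, b, x)\<close>, so that \<open>regressor_shift e r 0\<close>
  can be split off as the input term of the adaptive loop. The guard \<open>idx i = 1\<close> keeps
  \<open>nth_idx\<close> away from index 0, where it is arbitrary.\<close>

definition regressor_shift :: "real \<Rightarrow> real \<Rightarrow> 'n::{finite,linorder} param \<Rightarrow> 'n param"
  where "regressor_shift a b x = (\<chi> k. case k of
    Inl i \<Rightarrow> if idx i = 1 then a else x $ Inl (nth_idx (idx i - 1))
  | Inr i \<Rightarrow> if idx i = 1 then b else x $ Inr (nth_idx (idx i - 1)))"

lemma regressor_Suc: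
  "regressor y u (t + 1) =
    (regressor_shift (y (t + 1)) (u (t + 1)) (regressor y u t) :: 'n::{finite,linorder} param)"
proof -
  have "int (idx (nth_idx (idx i - 1) :: 'n)) = int (idx i) - 1" if "idx i \<noteq> 1" for i :: 'n
    using that idx_bounds[of i] by (subst idx_nth_idx) auto
  then show ?thesis
    by (auto simp: vec_eq_iff regressor_def regressor_shift_def split: sum.split
        intro!: arg_cong[of _ _ y] arg_cong[of _ _ u])
qed

lemma regressor_shift_add:
  "regressor_shift (a + a') (b + b') (x + x') = regressor_shift a b x + regressor_shift a' b' x'"
  by (auto simp: vec_eq_iff regressor_shift_def split: sum.split)

lemma regressor_shift_diff:
  "regressor_shift (a - a') (b - b') (x - x') = regressor_shift a b x - regressor_shift a' b' x'"
  by (auto simp: vec_eq_iff regressor_shift_def split: sum.split)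

lemma norm_regressor_shift_le:
  fixes x :: "'n::{finite,linorder} param"
  shows "norm (regressor_shift a b x) \<le> 2 * real CARD('n) * (\<bar>a\<bar> + \<bar>b\<bar> + norm x)"
proof -
  have "\<bar>regressor_shift a b x $ k\<bar> \<le> \<bar>a\<bar> + \<bar>b\<bar> + norm x" for k
  proof -
    have "\<bar>x $ j\<bar> \<le> \<bar>a\<bar> + \<bar>b\<bar> + norm x" for j using component_le_norm_cart[of x j] by linarith
    then show ?thesis by (auto simp: regressor_shift_def split: sum.split)
  qed
  then have "(\<Sum>k\<in>UNIV. \<bar>regressor_shift a b x $ k\<bar>) \<le> (\<Sum>k\<in>(UNIV :: ('n + 'n) set). \<bar>a\<bar> + \<bar>b\<bar> + norm x)"
    by (intro sum_mono)
  with norm_le_l1_cart[of "regressor_shift a b x"] show ?thesis by simp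
qed

text \<open>The control law with zero reference; the reference enters separately through
  \<open>filtered_reference\<close>.\<close>

definition control_map :: "'n coeffs \<times> 'n coeffs \<Rightarrow> 'n::{finite,linorder} param \<Rightarrow> real"
  where "control_map g x = - (\<Sum>i\<in>UNIV. fst g $ i * x $ Inr i) - (\<Sum>i\<in>UNIV. snd g $ i * x $ Inl i)"

lemma abs_control_map_le:
  fixes x :: "'n::{finite,linorder} param"
  shows "\<bar>control_map g x\<bar> \<le> 2 * real CARD('n) * norm g * norm x"
proof -
  have "\<bar>fst g $ i * x $ k\<bar> \<le> norm g * norm x" "\<bar>snd g $ i * x $ k\<bar> \<le> norm g * norm x" for i k
    unfolding abs_mult
    by (intro mult_mono component_le_norm_cart order.trans[OF component_le_norm_cart]
        norm_fst_le[of "fst g" "snd g", simplified] norm_snd_le[of "snd g" "fst g", simplified];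
      simp)+
  then have "(\<Sum>i\<in>UNIV. \<bar>fst g $ i * x $ Inr i\<bar>) \<le> (\<Sum>i\<in>(UNIV :: 'n set). norm g * norm x)"
    "(\<Sum>i\<in>UNIV. \<bar>snd g $ i * x $ Inl i\<bar>) \<le> (\<Sum>i\<in>(UNIV :: 'n set). norm g * norm x)"
    by (intro sum_mono; simp)+
  moreover have "\<bar>control_map g x\<bar> \<le> (\<Sum>i\<in>UNIV. \<bar>fst g $ i * x $ Inr i\<bar>) + (\<Sum>i\<in>UNIV. \<bar>snd g $ i * x $ Inl i\<bar>)"
    using sum_abs[of "\<lambda>i. fst g $ i * x $ Inr i" UNIV] sum_abs[of "\<lambda>i. snd g $ i * x $ Inl i" UNIV]
    unfolding control_map_def by linarith
  ultimately show ?thesis by simp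
qed

lemma control_map_add: "control_map g (x + x') = control_map g x + control_map g x'"
  by (simp add: control_map_def sum.distrib distrib_left)

lemma control_map_diff_left: "control_map (g - g') x = control_map g x - control_map g' x"
  by (simp add: control_map_def sum_subtractf algebra_simps)

text \<open>One step of the loop when the same \<open>\<theta>\<close> is both the plant and the
  model used for the design.\<close>

definition frozen_map :: "real poly \<Rightarrow> 'n::{finite,linorder} param \<Rightarrow> 'n param \<Rightarrow> 'n param"
  where "frozen_map Astar \<theta> x =
    regressor_shift (x \<bullet> \<theta>) (control_map (L_gain Astar \<theta>, P_gain Astar \<theta>) x) x"

lemma frozen_map_add: "frozen_map Astar \<theta> (x + x') = frozen_map Astar \<theta> x + frozen_map Astar \<theta> x'"
  by (simp add: frozen_map_def inner_add_left control_map_add regressor_shift_add)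

text \<open>Only the two newest entries depend on \<open>\<theta>\<close>. The difference of two
  frozen maps is thus a shift with old part 0, to which \<open>gains_lipschitz\<close>
  applies.\<close>

lemma frozen_map_bounds:
  fixes S :: "'n::{finite,linorder} param set"
  assumes adm: "admissible_params S" and st: "stable_target (2 * CARD('n)) Astar"
  shows "\<exists>G\<ge>1. \<exists>L\<ge>0.
    (\<forall>\<theta>\<in>S. \<forall>x. norm (frozen_map Astar \<theta> x) \<le> G * norm x) \<and>
    (\<forall>\<theta>\<in>S. \<forall>\<theta>'\<in>S. \<forall>x. norm (frozen_map Astar \<theta> x - frozen_map Astar \<theta>' x) \<le> L * norm (\<theta> - \<theta>') * norm x)"
proof -
  let ?n = "real CARD('n)"
  let ?g = "\<lambda>\<theta>. (L_gain Astar \<theta>, P_gain Astar \<theta>)"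
  obtain R L where RL: "R \<ge> 0" "L \<ge> 0" "\<And>\<theta>. \<theta> \<in> S \<Longrightarrow> norm (?g \<theta>) \<le> R"
    "\<And>\<theta> \<theta>'. \<lbrakk>\<theta> \<in> S; \<theta>' \<in> S\<rbrakk> \<Longrightarrow> norm (?g \<theta> - ?g \<theta>') \<le> L * norm (\<theta> - \<theta>')"
    using gains_lipschitz[OF adm st] by blast
  obtain s where s: "s \<ge> 0" "\<And>\<theta>. \<theta> \<in> S \<Longrightarrow> norm \<theta> \<le> s"
  proof -
    have "bounded S" using adm by (simp add: admissible_params_def compact_imp_bounded)
    then show ?thesis using that by (metis bounded_pos order_less_imp_le)
  qed
  have n1: "?n \<ge> 1" using zero_less_card_finite[where 'a='n] by linarith
  define G where "G = 2 * ?n * (s + 2 * ?n * R + 1)"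
  define L' where "L' = 2 * ?n * (1 + 2 * ?n * L)"
  have "1 \<le> 2 * ?n * 1" using n1 by linarith
  also have "\<dots> \<le> G" unfolding G_def using RL(1) s(1) by (intro mult_left_mono) auto
  finally have "G \<ge> 1" .
  moreover have "L' \<ge> 0" using RL(2) by (simp add: L'_def)
  moreover have "norm (frozen_map Astar \<theta> x) \<le> G * norm x" if \<theta>: "\<theta> \<in> S" for \<theta> x
  proof -
    have "\<bar>x \<bullet> \<theta>\<bar> \<le> s * norm x"
      using Cauchy_Schwarz_ineq2[of x \<theta>] mult_left_mono[OF s(2)[OF \<theta>], of "norm x"]
      by (simp add: mult.commute)
    moreover have "\<bar>control_map (?g \<theta>) x\<bar> \<le> 2 * ?n * R * norm x"
      by (intro order.trans[OF abs_control_map_le] mult_right_mono mult_left_mono RL(3) \<theta>) auto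
    ultimately have "\<bar>x \<bullet> \<theta>\<bar> + \<bar>control_map (?g \<theta>) x\<bar> + norm x \<le> (s + 2 * ?n * R + 1) * norm x"
      by (simp add: algebra_simps)
    then have "2 * ?n * (\<bar>x \<bullet> \<theta>\<bar> + \<bar>control_map (?g \<theta>) x\<bar> + norm x) \<le> G * norm x"
      unfolding G_def mult.assoc[of "2 * ?n"] by (intro mult_left_mono) auto
    then show ?thesis
      unfolding frozen_map_def by (rule order.trans[OF norm_regressor_shift_le])
  qed
  moreover have "norm (frozen_map Astar \<theta> x - frozen_map Astar \<theta>' x) \<le> L' * norm (\<theta> - \<theta>') * norm x"
    if \<theta>: "\<theta> \<in> S" "\<theta>' \<in> S" for \<theta> \<theta>' x
  proof -
    have eq: "frozen_map Astar \<theta> x - frozen_map Astar \<theta>' x =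
        regressor_shift (x \<bullet> (\<theta> - \<theta>')) (control_map (?g \<theta> - ?g \<theta>') x) 0"
      by (simp only: frozen_map_def regressor_shift_diff[symmetric] inner_diff_right
          control_map_diff_left diff_self)
    have "\<bar>x \<bullet> (\<theta> - \<theta>')\<bar> \<le> norm (\<theta> - \<theta>') * norm x"
      using Cauchy_Schwarz_ineq2[of x "\<theta> - \<theta>'"] by (simp add: mult.commute)
    moreover have "\<bar>control_map (?g \<theta> - ?g \<theta>') x\<bar> \<le> 2 * ?n * (L * norm (\<theta> - \<theta>')) * norm x"
      by (intro order.trans[OF abs_control_map_le] mult_right_mono mult_left_mono RL(4) \<theta>) auto
    ultimately have "\<bar>x \<bullet> (\<theta> - \<theta>')\<bar> + \<bar>control_map (?g \<theta> - ?g \<theta>') x\<bar> + norm (0 :: 'n param)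
        \<le> (1 + 2 * ?n * L) * (norm (\<theta> - \<theta>') * norm x)"
      by (simp add: algebra_simps)
    then have "2 * ?n * (\<bar>x \<bullet> (\<theta> - \<theta>')\<bar> + \<bar>control_map (?g \<theta> - ?g \<theta>') x\<bar> + norm (0 :: 'n param))
        \<le> 2 * ?n * ((1 + 2 * ?n * L) * (norm (\<theta> - \<theta>') * norm x))"
      by (intro mult_left_mono) auto
    also have "\<dots> = L' * norm (\<theta> - \<theta>') * norm x" by (simp add: L'_def)
    finally show ?thesis
      unfolding eq by (rule order.trans[OF norm_regressor_shift_le])
  qed
  ultimately show ?thesis by blast
qed

lemma frozen_trajectory:
  fixes x \<theta> :: "'n::{finite,linorder} param"
  assumes G: "1 \<le> G" "\<And>x. norm (frozen_map Astar \<theta> x) \<le> G * norm x"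
  obtains y u :: "int \<Rightarrow> real"
  where "\<And>k. regressor y u (int k) = (frozen_map Astar \<theta> ^^ k) x"
    and "\<And>j. \<bar>y j\<bar> \<le> G ^ nat j * norm x" and "\<And>j. \<bar>u j\<bar> \<le> G ^ nat j * norm x"
proof -
  let ?F = "frozen_map Astar \<theta>"
  \<comment> \<open>The past is read off \<open>x\<close>, where time \<open>j\<close> sits at index
    \<open>1 - j\<close>; later values are the newest entries of the iterates. Further back than
    \<open>x\<close> reaches, some arbitrary component of \<open>x\<close> is used, which still
    obeys the bound.\<close>
  define y where "y j = (if j \<le> 0 then x $ Inl (nth_idx (nat (1 - j))) else (?F ^^ nat j) x $ Inl (nth_idx 1))" for j :: int
  define u where "u j = (if j \<le> 0 then x $ Inr (nth_idx (nat (1 - j))) else (?F ^^ nat j) x $ Inr (nth_idx 1))" for j :: int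
  have n1: "1 \<le> CARD('n)" using zero_less_card_finite[where 'a='n] by linarith
  have growth: "norm ((?F ^^ k) x) \<le> G ^ k * norm x" for k
  proof (induction k)
    case (Suc k)
    have "norm ((?F ^^ Suc k) x) \<le> G * norm ((?F ^^ k) x)" using G(2) by simp
    also have "\<dots> \<le> G * (G ^ k * norm x)" using G(1) Suc by (intro mult_left_mono) auto
    finally show ?case by (simp add: mult.assoc)
  qed simp
  show ?thesis
  proof (rule that[of y u])
    show "regressor y u (int k) = (?F ^^ k) x" for k
    proof (induction k)
      case 0
      show ?case using idx_bounds(1)
        by (auto simp: vec_eq_iff regressor_def y_def u_def split: sum.split)
    next
      case (Suc k)
      have "y (int k + 1) = (?F ^^ Suc k) x $ Inl (nth_idx 1)"
        "u (int k + 1) = (?F ^^ Suc k) x $ Inr (nth_idx 1)"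
        by (simp_all add: y_def u_def nat_add_distrib)
      moreover have "idx (nth_idx 1 :: 'n) = 1" using n1 by (simp add: idx_nth_idx)
      ultimately have "y (int k + 1) = (?F ^^ k) x \<bullet> \<theta>"
        "u (int k + 1) = control_map (L_gain Astar \<theta>, P_gain Astar \<theta>) ((?F ^^ k) x)"
        by (simp_all add: frozen_map_def[of _ _ "(?F ^^ k) x"] regressor_shift_def)
      then have "regressor y u (int k + 1) = ?F ((?F ^^ k) x)"
        unfolding regressor_Suc by (simp add: Suc frozen_map_def[of _ _ "(?F ^^ k) x"])
      then show ?case by (simp add: add.commute)
    qed
    have "norm x \<le> G ^ nat j * norm x" for j
      using G(1) mult_right_mono[of 1 "G ^ nat j" "norm x"] by simp
    then show "\<bar>y j\<bar> \<le> G ^ nat j * norm x" "\<bar>u j\<bar> \<le> G ^ nat j * norm x" for j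
      using component_le_norm_cart[THEN order.trans, OF growth, of "nat j"]
        component_le_norm_cart[of x, THEN order.trans]
      by (auto simp: y_def u_def)
  qed
qed

text \<open>With shift operators the loop reads \<open>A y = B u\<close> and
  \<open>L u = - P y\<close>. Multiplying by \<open>L\<close> or \<open>B\<close> for
  \<open>y\<close>, by \<open>A\<close> or \<open>P\<close> for \<open>u\<close>, and using
  \<open>A * L + B * P\<close>, each signal is annihilated by the target polynomial, which does not
  involve \<open>\<theta>\<close>.\<close>

lemma frozen_recurrence:
  fixes \<theta> :: "'n::{finite,linorder} param" and y u :: "int \<Rightarrow> real"
  assumes adm: "admissible_params S" and st: "stable_target (2 * CARD('n)) Astar" and \<theta>: "\<theta> \<in> S"
    and reg: "\<And>k. regressor y u (int (Suc k)) = frozen_map Astar \<theta> (regressor y u (int k))"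
  shows "shift_op (z_mult (2 * CARD('n)) Astar) (\<lambda>j. y (int j + 1 - int CARD('n))) k = 0"
    and "shift_op (z_mult (2 * CARD('n)) Astar) (\<lambda>j. u (int j + 1 - int CARD('n))) k = 0"
proof -
  let ?n = "CARD('n)"
  \<comment> \<open>The offset places the oldest entry of the regressor at time 0 at index
    0.\<close>
  define Y where "Y j = y (int j + 1 - int ?n)" for j
  define U where "U j = u (int j + 1 - int ?n)" for j
  define A where "A = z_mult ?n (A_poly \<theta>)"
  define B where "B = z_mult ?n (B_poly \<theta>)"
  define L where "L = z_mult ?n (1 + shift_poly (L_gain Astar \<theta>))"
  define P where "P = z_mult ?n (shift_poly (P_gain Astar \<theta>))"
  have n1: "1 \<le> ?n" using zero_less_card_finite[where 'a='n] by linarith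
  have dL: "degree (1 + shift_poly (L_gain Astar \<theta> :: 'n coeffs)) \<le> ?n"
    by (intro degree_add_le degree_shift_poly) simp
  have bezout: "z_mult (2 * ?n) Astar = A * L + B * P"
    unfolding A_def B_def L_def P_def mult_2
    using arg_cong[OF pole_placement_identity[OF adm st \<theta>], of "z_mult (?n + ?n)"]
    by (simp add: z_mult_add[of "?n + ?n"] z_mult_mult degree_A_poly degree_B_poly degree_shift_poly dL)
  have "int ?n - int (idx i) = int (?n - idx i)" for i :: 'n
    using idx_bounds(2)[of i] by simp
  then have comp: "regressor y u (int k) $ Inl i = Y (k + ?n - idx i)"
    "regressor y u (int k) $ Inr i = U (k + ?n - idx i)" for k and i :: 'n
    using idx_bounds(2)[of i] by (simp_all add: regressor_def Y_def U_def of_nat_diff algebra_simps)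
  have step: "Y (k + ?n) = regressor y u (int k) \<bullet> \<theta>"
    "U (k + ?n) = control_map (L_gain Astar \<theta>, P_gain Astar \<theta>) (regressor y u (int k))" for k
  proof -
    have "idx (nth_idx 1 :: 'n) = 1" using n1 by (simp add: idx_nth_idx)
    then have "Y (k + ?n) = regressor y u (int (Suc k)) $ Inl (nth_idx 1 :: 'n)"
      "U (k + ?n) = regressor y u (int (Suc k)) $ Inr (nth_idx 1 :: 'n)"
      unfolding comp by simp_all
    then show "Y (k + ?n) = regressor y u (int k) \<bullet> \<theta>"
      "U (k + ?n) = control_map (L_gain Astar \<theta>, P_gain Astar \<theta>) (regressor y u (int k))"
      using \<open>idx (nth_idx 1 :: 'n) = 1\<close> unfolding reg by (simp_all add: frozen_map_def regressor_shift_def)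
  qed
  have AB: "shift_op A Y = shift_op B U"
  proof
    fix k
    show "shift_op A Y k = shift_op B U k"
      unfolding A_def B_def A_poly_def B_poly_def shift_op_1_plus_shift_poly shift_op_shift_poly step
      by (simp add: inner_vec_def sum_UNIV_sum comp sum_negf mult.commute)
  qed
  have LP: "shift_op L U = (\<lambda>k. - shift_op P Y k)"
  proof
    fix k
    show "shift_op L U k = - shift_op P Y k"
      unfolding L_def P_def shift_op_1_plus_shift_poly shift_op_shift_poly step
      by (simp add: control_map_def comp)
  qed
  have "shift_op (z_mult (2 * ?n) Astar) Y k = shift_op (L * A) Y k + shift_op (B * P) Y k"
    by (simp only: bezout shift_op_add mult.commute[of L])
  also have "\<dots> = shift_op (B * L) U k + shift_op (B * P) Y k"
    by (metis AB mult.commute shift_op_mult)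
  also have "\<dots> = 0" by (simp add: shift_op_mult LP shift_op_uminus_right)
  finally show "shift_op (z_mult (2 * ?n) Astar) (\<lambda>j. y (int j + 1 - int ?n)) k = 0"
    by (simp add: Y_def[abs_def])
  have "shift_op (z_mult (2 * ?n) Astar) U k = shift_op (A * L) U k + shift_op (P * B) U k"
    by (simp only: bezout shift_op_add mult.commute[of P])
  also have "\<dots> = - shift_op (A * P) Y k + shift_op (P * A) Y k"
    by (simp add: shift_op_mult LP shift_op_uminus_right AB)
  also have "\<dots> = 0" by (simp add: mult.commute[of P])
  finally show "shift_op (z_mult (2 * ?n) Astar) (\<lambda>j. u (int j + 1 - int ?n)) k = 0"
    by (simp add: U_def[abs_def])
qed

text \<open>Uniform in \<open>\<theta>\<close> because all \<open>\<theta>\<close> in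
  \<open>S\<close> share one recurrence; \<open>\<theta>\<close> influences only its first
  \<open>2 * CARD('n)\<close> values, which the common growth constant \<open>G\<close>
  bounds.\<close>

lemma frozen_decay:
  fixes S :: "'n::{finite,linorder} param set"
  assumes adm: "admissible_params S" and st: "stable_target (2 * CARD('n)) Astar"
    and mu: "max_root_modulus (2 * CARD('n)) Astar < \<mu>" "\<mu> \<le> 1"
  shows "\<exists>C\<ge>0. \<forall>\<theta>\<in>S. \<forall>k x. norm ((frozen_map Astar \<theta> ^^ k) x) \<le> C * \<mu> ^ k * norm x"
proof -
  let ?n = "CARD('n)"
  have n1: "1 \<le> ?n" using zero_less_card_finite[where 'a='n] by linarith
  then have m: "0 < 2 * ?n" by simp
  have mu0: "0 < \<mu>" by (rule target_decay(1)[OF st m mu])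
  obtain C where C: "C \<ge> 0" "\<And>w K t. \<lbrakk>\<forall>j<2 * ?n. \<bar>w j\<bar> \<le> K;
      \<forall>t. shift_op (z_mult (2 * ?n) Astar) w t = 0\<rbrakk> \<Longrightarrow> \<bar>w t\<bar> \<le> C * K * \<mu> ^ t"
    using target_decay(2)[OF st m mu] by blast
  obtain G where G: "G \<ge> 1" "\<And>\<theta> x. \<theta> \<in> S \<Longrightarrow> norm (frozen_map Astar \<theta> x) \<le> G * norm x"
    using frozen_map_bounds[OF adm st] by blast
  define C' where "C' = 2 * real ?n * (C * G ^ (2 * ?n))"
  have "norm ((frozen_map Astar \<theta> ^^ k) x) \<le> C' * \<mu> ^ k * norm x" if \<theta>: "\<theta> \<in> S" for \<theta> k x
  proof -
    obtain y u :: "int \<Rightarrow> real" where yu: "\<And>k. regressor y u (int k) = (frozen_map Astar \<theta> ^^ k) x"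
      "\<And>j. \<bar>y j\<bar> \<le> G ^ nat j * norm x" "\<And>j. \<bar>u j\<bar> \<le> G ^ nat j * norm x"
      using frozen_trajectory[OF G(1) G(2)[OF \<theta>]] by blast
    have ini: "G ^ nat (int j + 1 - int ?n) * norm x \<le> G ^ (2 * ?n) * norm x" if "j < 2 * ?n" for j
      using that n1 G(1) by (intro mult_right_mono power_increasing) auto
    define b where "b = C * (G ^ (2 * ?n) * norm x) * \<mu> ^ k"
    \<comment> \<open>Every entry of the regressor at time \<open>k\<close> has index at least
      \<open>k\<close> in the shifted sequence, so \<open>\<mu> \<le> 1\<close> gives the factor
      \<open>\<mu> ^ k\<close>.\<close>
    have b: "C * (G ^ (2 * ?n) * norm x) * \<mu> ^ (k + ?n - idx i) \<le> b" for i :: 'n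
      unfolding b_def using idx_bounds(2)[of i] mu0 mu(2) C(1) G(1)
      by (intro mult_left_mono power_decreasing) auto
    have reg: "regressor y u (int (Suc k)) = frozen_map Astar \<theta> (regressor y u (int k))" for k
      by (simp only: yu funpow.simps comp_def)
    have i: "int k + 1 - int (idx i) = int (k + ?n - idx i) + 1 - int ?n" for i :: 'n
      using idx_bounds(2)[of i] by simp
    have "\<bar>y (int k + 1 - int (idx i))\<bar> \<le> b" for i :: 'n
      unfolding i
      by (rule order.trans[OF C(2)[of "\<lambda>j. y (int j + 1 - int ?n)"] b])
        (use frozen_recurrence(1)[OF adm st \<theta> reg] order.trans[OF yu(2) ini] in blast)+
    moreover have "\<bar>u (int k + 1 - int (idx i))\<bar> \<le> b" for i :: 'n
      unfolding i
      by (rule order.trans[OF C(2)[of "\<lambda>j. u (int j + 1 - int ?n)"] b])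
        (use frozen_recurrence(2)[OF adm st \<theta> reg] order.trans[OF yu(3) ini] in blast)+
    ultimately have "\<bar>(regressor y u (int k) :: 'n param) $ j\<bar> \<le> b" for j
      by (auto simp: regressor_def split: sum.split)
    then have "(\<Sum>j\<in>UNIV. \<bar>(regressor y u (int k) :: 'n param) $ j\<bar>) \<le> (\<Sum>j\<in>(UNIV :: ('n + 'n) set). b)"
      by (intro sum_mono)
    also have "\<dots> = C' * \<mu> ^ k * norm x" by (simp add: b_def C'_def)
    finally show ?thesis
      using norm_le_l1_cart[of "regressor y u (int k) :: 'n param"] by (simp add: yu(1))
  qed
  moreover have "C' \<ge> 0" using C(1) G(1) by (simp add: C'_def)
  ultimately show ?thesis by blast
qed


subsection \<open>A Lyapunov function for the adaptive loop\<close>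

text \<open>
  The weights \<open>\<mu>\<^sup>-\<^sup>k\<close> turn a uniform decay bound into a one-step contraction of a norm that
  depends on \<open>\<theta>\<close>, since the sum telescopes under \<open>F \<theta>\<close>; unlike a supremum over \<open>k\<close>, the
  finite sum is visibly Lipschitz in \<open>\<theta>\<close>.
\<close>

lemma frozen_lyapunov:
  fixes F :: "'p::real_normed_vector \<Rightarrow> 'a::real_normed_vector \<Rightarrow> 'a"
  assumes add: "\<And>\<theta> x y. F \<theta> (x + y) = F \<theta> x + F \<theta> y"
    and bdd: "\<And>\<theta> x. \<theta> \<in> S \<Longrightarrow> norm (F \<theta> x) \<le> G * norm x"
    and lip: "\<And>\<theta> \<theta>' x. \<lbrakk>\<theta> \<in> S; \<theta>' \<in> S\<rbrakk> \<Longrightarrow> norm (F \<theta> x - F \<theta>' x) \<le> L * norm (\<theta> - \<theta>') * norm x"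
    and decay: "\<And>\<theta> k x. \<theta> \<in> S \<Longrightarrow> norm ((F \<theta> ^^ k) x) \<le> C * \<mu>' ^ k * norm x"
    and "0 \<le> G" "0 \<le> L" "0 \<le> C" "0 < \<mu>'" "\<mu>' < \<mu>"
  obtains V M K where "0 \<le> M" and "0 \<le> K"
    and "\<And>\<theta> x. norm x \<le> V \<theta> x"
    and "\<And>\<theta> x. \<theta> \<in> S \<Longrightarrow> V \<theta> x \<le> M * norm x"
    and "\<And>\<theta> x. \<theta> \<in> S \<Longrightarrow> V \<theta> (F \<theta> x) \<le> \<mu> * V \<theta> x"
    and "\<And>\<theta> x y. V \<theta> (x + y) \<le> V \<theta> x + V \<theta> y"
    and "\<And>\<theta> \<theta>' x. \<lbrakk>\<theta> \<in> S; \<theta>' \<in> S\<rbrakk> \<Longrightarrow> V \<theta>' x \<le> V \<theta> x + K * norm (\<theta>' - \<theta>) * norm x"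
proof -
  have \<mu>: "0 < \<mu>" using assms by linarith
  have "\<mu>' / \<mu> < 1" using assms by simp
  then have "(\<lambda>N. C * (\<mu>' / \<mu>) ^ N) \<longlonglongrightarrow> C * 0"
    using assms \<mu> by (intro tendsto_mult tendsto_const LIMSEQ_power_zero) auto
  then have "eventually (\<lambda>N. C * (\<mu>' / \<mu>) ^ N < 1) sequentially"
    by (intro order_tendstoD(2)[of _ "C * 0"]) auto
  then have "eventually (\<lambda>N. C * (\<mu>' / \<mu>) ^ N < 1 \<and> 1 \<le> N) sequentially"
    using eventually_ge_at_top[of 1] by (rule eventually_conj)
  \<comment> \<open>The first condition makes the end term of the telescoping sum at most
    \<open>norm x\<close>; the second keeps the term \<open>norm x\<close> itself in the
    sum.\<close>
  then obtain N where N: "C * (\<mu>' / \<mu>) ^ N < 1" "1 \<le> N"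
    by (auto dest: eventually_happens)
  have powlip: "\<exists>l\<ge>0. \<forall>\<theta>\<in>S. \<forall>\<theta>'\<in>S. \<forall>x. norm ((F \<theta> ^^ k) x - (F \<theta>' ^^ k) x) \<le> l * norm (\<theta> - \<theta>') * norm x" for k
  proof (induction k)
    case (Suc k)
    then obtain l where l: "l \<ge> 0"
      "\<And>\<theta> \<theta>' x. \<lbrakk>\<theta> \<in> S; \<theta>' \<in> S\<rbrakk> \<Longrightarrow> norm ((F \<theta> ^^ k) x - (F \<theta>' ^^ k) x) \<le> l * norm (\<theta> - \<theta>') * norm x"
      by blast
    show ?case
    proof (intro exI[of _ "G * l + L * (C * \<mu>' ^ k)"] conjI ballI allI)
      fix \<theta> \<theta>' x assume \<theta>: "\<theta> \<in> S" "\<theta>' \<in> S"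
      have sub: "F \<theta> (a - b) = F \<theta> a - F \<theta> b" for a b
        using add[of \<theta> "a - b" b] by simp
      let ?a = "(F \<theta> ^^ k) x" and ?b = "(F \<theta>' ^^ k) x"
      \<comment> \<open>The first summand carries the Lipschitz bound for \<open>k\<close> forward,
        the second is the change of the last factor.\<close>
      have "(F \<theta> ^^ Suc k) x - (F \<theta>' ^^ Suc k) x = F \<theta> (?a - ?b) + (F \<theta> ?b - F \<theta>' ?b)"
        by (simp add: sub)
      also have "norm \<dots> \<le> G * norm (?a - ?b) + L * norm (\<theta> - \<theta>') * norm ?b"
        by (intro norm_triangle_mono bdd lip \<theta>)
      also have "\<dots> \<le> G * (l * norm (\<theta> - \<theta>') * norm x) + L * norm (\<theta> - \<theta>') * (C * \<mu>' ^ k * norm x)"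
        using assms by (intro add_mono mult_left_mono l decay \<theta>) auto
      finally show "norm ((F \<theta> ^^ Suc k) x - (F \<theta>' ^^ Suc k) x)
          \<le> (G * l + L * (C * \<mu>' ^ k)) * norm (\<theta> - \<theta>') * norm x"
        by (simp add: algebra_simps)
    qed (use assms l(1) in simp)
  qed auto
  then have "\<forall>k. \<exists>l. l \<ge> 0 \<and> (\<forall>\<theta>\<in>S. \<forall>\<theta>'\<in>S. \<forall>x.
      norm ((F \<theta> ^^ k) x - (F \<theta>' ^^ k) x) \<le> l * norm (\<theta> - \<theta>') * norm x)" by blast
  from choice[OF this] obtain l where l': "\<forall>k. l k \<ge> 0 \<and> (\<forall>\<theta>\<in>S. \<forall>\<theta>'\<in>S. \<forall>x.
      norm ((F \<theta> ^^ k) x - (F \<theta>' ^^ k) x) \<le> l k * norm (\<theta> - \<theta>') * norm x)" ..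
  then have l: "\<And>k. l k \<ge> 0"
    "\<And>k \<theta> \<theta>' x. \<lbrakk>\<theta> \<in> S; \<theta>' \<in> S\<rbrakk> \<Longrightarrow> norm ((F \<theta> ^^ k) x - (F \<theta>' ^^ k) x) \<le> l k * norm (\<theta> - \<theta>') * norm x"
    by simp_all
  define V where "V \<theta> x = (\<Sum>k<N. (1 / \<mu>) ^ k * norm ((F \<theta> ^^ k) x))" for \<theta> x
  define M where "M = (\<Sum>k<N. (1 / \<mu>) ^ k * (C * \<mu>' ^ k))"
  define K where "K = (\<Sum>k<N. (1 / \<mu>) ^ k * l k)"
  have V1: "norm x \<le> V \<theta> x" for \<theta> x
  proof -
    have "(1 / \<mu>) ^ 0 * norm ((F \<theta> ^^ 0) x) \<le> V \<theta> x"
      unfolding V_def using N(2) \<mu> by (intro member_le_sum) auto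
    then show ?thesis by simp
  qed
  have V2: "V \<theta> x \<le> M * norm x" if "\<theta> \<in> S" for \<theta> x
  proof -
    have "V \<theta> x \<le> (\<Sum>k<N. (1 / \<mu>) ^ k * (C * \<mu>' ^ k * norm x))"
      unfolding V_def using \<mu> by (intro sum_mono mult_left_mono decay that) auto
    then show ?thesis by (simp add: M_def sum_distrib_right mult.assoc)
  qed
  have V3: "V \<theta> (F \<theta> x) \<le> \<mu> * V \<theta> x" if "\<theta> \<in> S" for \<theta> x
  proof -
    have "V \<theta> (F \<theta> x) = \<mu> * (\<Sum>k<N. (1 / \<mu>) ^ Suc k * norm ((F \<theta> ^^ Suc k) x))"
      using \<mu> by (simp add: V_def sum_distrib_left funpow_swap1)
    \<comment> \<open>Shifting the index drops the term \<open>k = 0\<close>, which is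
      \<open>norm x\<close>, and adds the term \<open>k = N\<close>, which the choice of
      \<open>N\<close> makes no larger.\<close>
    also have "(\<Sum>k<N. (1 / \<mu>) ^ Suc k * norm ((F \<theta> ^^ Suc k) x)) =
        (\<Sum>k<Suc N. (1 / \<mu>) ^ k * norm ((F \<theta> ^^ k) x)) - norm x"
      by (subst sum.lessThan_Suc_shift) simp
    also have "\<dots> = V \<theta> x + ((1 / \<mu>) ^ N * norm ((F \<theta> ^^ N) x) - norm x)"
      by (simp add: V_def)
    also have "\<mu> * \<dots> \<le> \<mu> * (V \<theta> x + 0)"
    proof (intro mult_left_mono add_left_mono)
      have "(1 / \<mu>) ^ N * norm ((F \<theta> ^^ N) x) \<le> (1 / \<mu>) ^ N * (C * \<mu>' ^ N * norm x)"
        using \<mu> by (intro mult_left_mono decay that) auto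
      also have "\<dots> = C * (\<mu>' / \<mu>) ^ N * norm x" by (simp add: power_divide)
      also have "\<dots> \<le> 1 * norm x" using N(1) by (intro mult_right_mono) auto
      finally show "(1 / \<mu>) ^ N * norm ((F \<theta> ^^ N) x) - norm x \<le> 0" by simp
    qed (use \<mu> in simp)
    finally show ?thesis by simp
  qed
  have V4: "V \<theta> (x + y) \<le> V \<theta> x + V \<theta> y" for \<theta> x y
  proof -
    have "(F \<theta> ^^ k) (x + y) = (F \<theta> ^^ k) x + (F \<theta> ^^ k) y" for k
      by (induction k) (simp_all add: add)
    then show ?thesis
      unfolding V_def sum.distrib[symmetric] distrib_left[symmetric]
      using \<mu> by (intro sum_mono mult_left_mono) (auto intro: norm_triangle_ineq)
  qed
  have V5: "V \<theta>' x \<le> V \<theta> x + K * norm (\<theta>' - \<theta>) * norm x" if "\<theta> \<in> S" "\<theta>' \<in> S" for \<theta> \<theta>' x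
  proof -
    have "V \<theta>' x \<le> (\<Sum>k<N. (1 / \<mu>) ^ k * (norm ((F \<theta> ^^ k) x) + l k * norm (\<theta>' - \<theta>) * norm x))"
      unfolding V_def
    proof (intro sum_mono mult_left_mono)
      fix k
      show "norm ((F \<theta>' ^^ k) x) \<le> norm ((F \<theta> ^^ k) x) + l k * norm (\<theta>' - \<theta>) * norm x"
        using l(2)[OF that(2,1), of k x] norm_triangle_sub[of "(F \<theta>' ^^ k) x" "(F \<theta> ^^ k) x"] by linarith
    qed (use \<mu> in simp)
    also have "\<dots> = V \<theta> x + K * norm (\<theta>' - \<theta>) * norm x"
      by (simp add: V_def K_def distrib_left sum.distrib sum_distrib_right mult.assoc)
    finally show ?thesis .
  qed
  have V6: "M \<ge> 0" "K \<ge> 0" using assms \<mu> l(1) by (auto simp: M_def K_def intro!: sum_nonneg)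
  show thesis by (rule that) (fact V1 V2 V3 V4 V5 V6)+
qed

section \<open>The estimator update and the one-step Lyapunov inequality\<close>

lemma norm_le_set_norm:
  assumes "compact S" "x \<in> S" shows "norm x \<le> set_norm S"
proof -
  have "bdd_above (norm ` S)"
    using compact_imp_bounded[OF assms(1)] by (auto simp: bounded_iff bdd_above_def)
  then show ?thesis unfolding set_norm_def by (intro cSUP_upper assms)
qed

text \<open>
  The assumption \<open>\<bar>d\<bar> < \<nu> \<parallel>\<phi>\<parallel>\<close> with \<open>\<nu> \<le> \<delta>\<close> forces \<open>rho = 1\<close>, also when \<open>\<delta> = \<infinity>\<close>.
\<close>

lemma estimator_step_good:
  fixes S :: "'a::euclidean_space set"
  assumes S: "convex S" "compact S" and \<theta>: "\<theta> \<in> S" "\<theta>s \<in> S"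
    and \<nu>: "ereal \<nu> \<le> \<delta>" and good: "\<bar>d\<bar> < \<nu> * norm \<phi>"
    and e: "e = \<phi> \<bullet> \<theta>s + d - \<phi> \<bullet> \<theta>"
  shows "\<bar>e\<bar> < (2 * set_norm S + \<nu>) * norm \<phi>"
    and "norm (estimator_step S \<delta> \<phi> e \<theta> - \<theta>) \<le> \<bar>e\<bar> / norm \<phi>"
    and "(norm (estimator_step S \<delta> \<phi> e \<theta> - \<theta>s))\<^sup>2
      \<le> (norm (\<theta> - \<theta>s))\<^sup>2 - (\<bar>e\<bar> / norm \<phi>)\<^sup>2 / 2 + 2 * \<nu>\<^sup>2"
proof -
  have \<phi>: "norm \<phi> > 0" using good by (cases "\<phi> = 0") auto
  have "\<bar>\<phi> \<bullet> (\<theta>s - \<theta>)\<bar> \<le> norm \<phi> * norm (\<theta>s - \<theta>)" by (rule Cauchy_Schwarz_ineq2)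
  also have "\<dots> \<le> norm \<phi> * (2 * set_norm S)"
    using norm_triangle_ineq4[of \<theta>s \<theta>] norm_le_set_norm[OF S(2) \<theta>(1)] norm_le_set_norm[OF S(2) \<theta>(2)]
    by (intro mult_left_mono) auto
  finally have "\<bar>\<phi> \<bullet> \<theta>s - \<phi> \<bullet> \<theta>\<bar> \<le> 2 * set_norm S * norm \<phi>" by (simp add: inner_diff_right mult_ac)
  with good show eb: "\<bar>e\<bar> < (2 * set_norm S + \<nu>) * norm \<phi>" by (simp add: e distrib_right)
  have "ereal \<bar>e\<bar> < (ereal (2 * set_norm S) + ereal \<nu>) * ereal (norm \<phi>)" using eb by simp
  also have "\<dots> \<le> (ereal (2 * set_norm S) + \<delta>) * ereal (norm \<phi>)"
    using \<nu> by (intro ereal_mult_right_mono add_left_mono) auto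
  finally have rho: "rho S \<delta> \<phi> e = 1" by (simp add: rho_def)
  define x where "x = \<theta> + (e / (\<phi> \<bullet> \<phi>)) *\<^sub>R \<phi>"
  have step: "estimator_step S \<delta> \<phi> e \<theta> = closest_point S x"
    by (simp add: estimator_step_def rho x_def)
  \<comment> \<open>Projection onto a convex set is nonexpansive and fixes the points of
    \<open>S\<close>; used with the old estimate and with the true parameter.\<close>
  have proj: "norm (closest_point S x - \<psi>) \<le> norm (x - \<psi>)" if "\<psi> \<in> S" for \<psi>
    using closest_point_lipschitz[OF S(1) compact_imp_closed[OF S(2)], of x \<psi>] that
    by (auto simp: closest_point_self dist_norm)
  have "norm (x - \<theta>) = \<bar>e\<bar> / norm \<phi>"
    using \<phi> by (simp add: x_def power2_norm_eq_inner[symmetric] power2_eq_square)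
  then show "norm (estimator_step S \<delta> \<phi> e \<theta> - \<theta>) \<le> \<bar>e\<bar> / norm \<phi>"
    using proj[OF \<theta>(1)] by (simp add: step)
  have "(norm (closest_point S x - \<theta>s))\<^sup>2 \<le> (norm (x - \<theta>s))\<^sup>2"
    using proj[OF \<theta>(2)] by (intro power_mono) auto
  also have "x - \<theta>s = (\<theta> - \<theta>s) + (e / (\<phi> \<bullet> \<phi>)) *\<^sub>R \<phi>" by (simp add: x_def)
  also have "(norm \<dots>)\<^sup>2 = (norm (\<theta> - \<theta>s))\<^sup>2
      + 2 * (e / (\<phi> \<bullet> \<phi>)) * (\<phi> \<bullet> (\<theta> - \<theta>s)) + (e / (\<phi> \<bullet> \<phi>))\<^sup>2 * (\<phi> \<bullet> \<phi>)"
    unfolding power2_norm_eq_inner inner_add_left inner_add_right inner_scaleR_left inner_scaleR_right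
      inner_commute[of "\<theta> - \<theta>s" \<phi>]
    by (simp add: power2_eq_square add_divide_distrib distrib_left)
  also have "\<phi> \<bullet> (\<theta> - \<theta>s) = d - e" by (simp add: e inner_diff_right)
  also have "(norm (\<theta> - \<theta>s))\<^sup>2 + 2 * (e / (\<phi> \<bullet> \<phi>)) * (d - e) + (e / (\<phi> \<bullet> \<phi>))\<^sup>2 * (\<phi> \<bullet> \<phi>)
      = (norm (\<theta> - \<theta>s))\<^sup>2 + (2 * e * d - e\<^sup>2) / (norm \<phi>)\<^sup>2"
    using \<phi> by (simp add: power2_norm_eq_inner[symmetric] field_simps power2_eq_square)
  \<comment> \<open>Young's inequality on the cross term keeps half of the decrease in
    \<open>e\<close> and charges the rest to \<open>d\<close>.\<close>
  also have "\<dots> \<le> (norm (\<theta> - \<theta>s))\<^sup>2 + (2 * d\<^sup>2 - e\<^sup>2 / 2) / (norm \<phi>)\<^sup>2"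
  proof -
    have "0 \<le> (e - 2 * d)\<^sup>2 / 2" by simp
    then have "2 * e * d - e\<^sup>2 \<le> 2 * d\<^sup>2 - e\<^sup>2 / 2" by (simp add: power2_eq_square algebra_simps)
    then show ?thesis by (intro add_left_mono divide_right_mono) auto
  qed
  also have "\<dots> \<le> (norm (\<theta> - \<theta>s))\<^sup>2 - (\<bar>e\<bar> / norm \<phi>)\<^sup>2 / 2 + 2 * \<nu>\<^sup>2"
  proof -
    have "\<bar>d\<bar>\<^sup>2 \<le> (\<nu> * norm \<phi>)\<^sup>2" using good by (intro power_mono) auto
    then have "d\<^sup>2 / (norm \<phi>)\<^sup>2 \<le> \<nu>\<^sup>2" using \<phi> by (simp add: power_mult_distrib field_simps)
    then show ?thesis by (simp add: diff_divide_distrib power_divide)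
  qed
  finally show "(norm (estimator_step S \<delta> \<phi> e \<theta> - \<theta>s))\<^sup>2
      \<le> (norm (\<theta> - \<theta>s))\<^sup>2 - (\<bar>e\<bar> / norm \<phi>)\<^sup>2 / 2 + 2 * \<nu>\<^sup>2" by (simp add: step)
qed

text \<open>A statement about a single step, with \<open>W\<close>, \<open>M\<close> and
  \<open>c\<close> chosen before the parameters, the regressor and the inputs; this order makes the
  final constant uniform. \<open>W\<close> may depend on the unknown \<open>\<theta>s\<close>, as it
  serves only the analysis.\<close>

lemma closed_loop_lyapunov:
  fixes S :: "'n::{finite,linorder} param set"
  assumes adm: "admissible_params S" and st: "stable_target (2 * CARD('n)) Astar" and \<delta>: "0 < \<delta>"
    and lam: "max_root_modulus (2 * CARD('n)) Astar < lam" "lam < 1"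
  shows "\<exists>W. \<exists>M\<ge>0. \<exists>c\<ge>0. \<forall>\<theta>s\<in>S. \<forall>\<theta>\<in>S. \<forall>\<phi> d r e.
    norm \<phi> \<le> W \<theta>s \<theta> \<phi> \<and> W \<theta>s \<theta> \<phi> \<le> M * norm \<phi> \<and>
    (e = \<phi> \<bullet> \<theta>s + d - \<phi> \<bullet> \<theta> \<longrightarrow>
      W \<theta>s (estimator_step S \<delta> \<phi> e \<theta>) (frozen_map Astar \<theta> \<phi> + regressor_shift e r 0)
        \<le> lam * W \<theta>s \<theta> \<phi> + c * (\<bar>r\<bar> + \<bar>d\<bar>))"
proof -
  let ?n = "real CARD('n)"
  let ?F = "frozen_map Astar"
  have S: "S \<noteq> {}" "convex S" "compact S" using adm by (auto simp: admissible_params_def)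
  have m: "0 < 2 * CARD('n)" by simp
  obtain \<mu> where \<mu>: "max_root_modulus (2 * CARD('n)) Astar < \<mu>" "\<mu> < lam" using dense[OF lam(1)] by blast
  obtain \<mu>' where \<mu>': "max_root_modulus (2 * CARD('n)) Astar < \<mu>'" "\<mu>' < \<mu>" using dense[OF \<mu>(1)] by blast
  have \<mu>'1: "\<mu>' \<le> 1" using \<mu> \<mu>' lam by linarith
  have \<mu>'0: "0 < \<mu>'" by (rule target_decay(1)[OF st m \<mu>'(1) \<mu>'1])
  then have \<mu>0: "0 < \<mu>" using \<mu>' by linarith
  obtain G L where GL: "G \<ge> 1" "L \<ge> 0" "\<And>\<theta> x. \<theta> \<in> S \<Longrightarrow> norm (?F \<theta> x) \<le> G * norm x"
    "\<And>\<theta> \<theta>' x. \<lbrakk>\<theta> \<in> S; \<theta>' \<in> S\<rbrakk> \<Longrightarrow> norm (?F \<theta> x - ?F \<theta>' x) \<le> L * norm (\<theta> - \<theta>') * norm x"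
    using frozen_map_bounds[OF adm st] by blast
  obtain C where C: "C \<ge> 0" "\<And>\<theta> k x. \<theta> \<in> S \<Longrightarrow> norm ((?F \<theta> ^^ k) x) \<le> C * \<mu>' ^ k * norm x"
    using frozen_decay[OF adm st \<mu>'(1) \<mu>'1] by blast
  have G0: "0 \<le> G" using GL(1) by simp
  obtain V M K where MK: "0 \<le> M" "0 \<le> K"
    and V: "\<And>\<theta> x. norm x \<le> V \<theta> x"
      "\<And>\<theta> x. \<theta> \<in> S \<Longrightarrow> V \<theta> x \<le> M * norm x"
      "\<And>\<theta> x. \<theta> \<in> S \<Longrightarrow> V \<theta> (?F \<theta> x) \<le> \<mu> * V \<theta> x"
      "\<And>\<theta> x y. V \<theta> (x + y) \<le> V \<theta> x + V \<theta> y"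
    and Vlip: "\<And>\<theta> \<theta>' x. \<lbrakk>\<theta> \<in> S; \<theta>' \<in> S\<rbrakk> \<Longrightarrow> V \<theta>' x \<le> V \<theta> x + K * norm (\<theta>' - \<theta>) * norm x"
  proof (rule frozen_lyapunov[where F = ?F and S = S and G = G and L = L and C = C
        and \<mu>' = \<mu>' and \<mu> = \<mu>], goal_cases)
    case (10 V M K)
    from 10(2-) show ?case by (rule that)
  qed (rule frozen_map_add GL G0 C \<mu>'0 \<mu>'(2) | assumption)+
  define M2 where "M2 = M * (2 * ?n)"
  define K2 where "K2 = K + M2 / \<mu>"
  \<comment> \<open>Half of the logarithmic gap: one \<open>\<epsilon>\<close> is spent on
    completing the square in \<open>K2 * x\<close>, which dictates \<open>H\<close>, the other on
    the disturbance term \<open>4 * H * \<nu>\<^sup>2\<close>. \<open>D\<close> bounds distances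
    within \<open>S\<close> as well as the relative error \<open>x\<close>, and \<open>E\<close>
    bounds the exponential weight.\<close>
  define \<epsilon> where "\<epsilon> = ln (lam / \<mu>) / 2"
  define H where "H = K2\<^sup>2 / (4 * \<epsilon>)"
  define D where "D = 2 * set_norm S + 1"
  define E where "E = exp (2 * H * D\<^sup>2)"
  have M20: "M2 \<ge> 0" using MK by (simp add: M2_def)
  have \<epsilon>: "\<epsilon> > 0" using \<mu>0 \<mu>(2) by (simp add: \<epsilon>_def)
  have lam\<mu>: "\<mu> * exp (2 * \<epsilon>) = lam"
  proof -
    have "exp (2 * \<epsilon>) = lam / \<mu>" unfolding \<epsilon>_def using \<mu>0 \<mu>(2) by simp
    then show ?thesis using \<mu>0 by simp
  qed
  have H0: "H \<ge> 0" using \<epsilon> by (simp add: H_def)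
  have H: "K2 * x \<le> \<epsilon> + H * x\<^sup>2" for x
  proof -
    have "0 \<le> (K2 * x - 2 * \<epsilon>)\<^sup>2" by simp
    then have "(K2 * x - \<epsilon>) * (4 * \<epsilon>) \<le> K2\<^sup>2 * x\<^sup>2" by (simp add: power2_eq_square algebra_simps)
    then have "K2 * x - \<epsilon> \<le> K2\<^sup>2 * x\<^sup>2 / (4 * \<epsilon>)" using \<epsilon> by (subst pos_le_divide_eq) auto
    then show ?thesis by (simp add: H_def)
  qed
  have D1: "D \<ge> 1"
  proof -
    obtain \<theta> where "\<theta> \<in> S" using S(1) by blast
    from norm_le_set_norm[OF S(3) this] norm_ge_zero[of \<theta>] have "0 \<le> set_norm S" by linarith
    then show ?thesis by (simp add: D_def)
  qed
  obtain \<delta>0 where \<delta>0: "0 < \<delta>0" "ereal \<delta>0 \<le> \<delta>"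
  proof -
    from ereal_dense2[OF \<delta>] obtain q where "0 < ereal q" "ereal q < \<delta>" by blast
    then show ?thesis by (intro that[of q]) auto
  qed
  \<comment> \<open>The three bounds give \<open>x \<le> D\<close>, force an update of the estimate,
    and yield \<open>4 * H * \<nu>\<^sup>2 \<le> \<epsilon>\<close>. The real
    \<open>\<delta>0\<close> stands in for a possibly infinite \<open>\<delta>\<close>, and
    \<open>+ 1\<close> guards against \<open>H = 0\<close>.\<close>
  define \<nu> where "\<nu> = min 1 (min \<delta>0 (\<epsilon> / (4 * H + 1)))"
  have \<nu>0: "\<nu> > 0" using \<delta>0 \<epsilon> H0 by (simp add: \<nu>_def)
  have \<nu>1: "\<nu> \<le> 1" by (simp add: \<nu>_def)
  have "\<nu> \<le> \<delta>0" by (simp add: \<nu>_def)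
  then have "ereal \<nu> \<le> ereal \<delta>0" by (simp only: ereal_less_eq)
  then have \<nu>\<delta>: "ereal \<nu> \<le> \<delta>" using \<delta>0(2) by (rule order.trans)
  have \<nu>H: "4 * H * \<nu>\<^sup>2 \<le> \<epsilon>"
  proof -
    have "\<nu>\<^sup>2 \<le> \<nu>" using \<nu>0 \<nu>1 power_decreasing[of 1 2 \<nu>] by simp
    then have "4 * H * \<nu>\<^sup>2 \<le> (4 * H + 1) * \<nu>"
      using H0 \<nu>0 by (intro mult_mono) auto
    also have "\<dots> \<le> (4 * H + 1) * (\<epsilon> / (4 * H + 1))"
      using H0 by (intro mult_left_mono) (auto simp: \<nu>_def)
    finally show ?thesis using H0 by simp
  qed
  \<comment> \<open>The factor 2 in the exponent compensates the 1/2 in the decrease of the squared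
    parameter error. In \<open>c\<close>, the first summand handles \<open>r\<close> when
    \<open>d\<close> is relatively small, the second the opposite case.\<close>
  define W where "W \<theta>s \<theta> \<phi> = V \<theta> \<phi> * exp (2 * H * (norm (\<theta> - \<theta>s))\<^sup>2)" for \<theta>s \<theta> \<phi> :: "'n param"
  define c where "c = E * ((1 + K * D) * M2) + E * (M * ((G + 2 * ?n * D) / \<nu> + 2 * ?n))"
  have E1: "1 \<le> exp (2 * H * (norm (\<theta> - \<theta>s))\<^sup>2)" for \<theta> \<theta>s :: "'n param" using H0 by simp
  have dist: "norm (\<theta> - \<theta>s) \<le> D" if "\<theta> \<in> S" "\<theta>s \<in> S" for \<theta> \<theta>s
    using norm_triangle_ineq4[of \<theta> \<theta>s] norm_le_set_norm[OF S(3) that(1)] norm_le_set_norm[OF S(3) that(2)]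
    by (simp add: D_def)
  have EE: "exp (2 * H * (norm (\<theta> - \<theta>s))\<^sup>2) \<le> E" if "\<theta> \<in> S" "\<theta>s \<in> S" for \<theta> \<theta>s
    using dist[OF that] H0 by (simp add: E_def power_mono mult_left_mono)
  have V0: "0 \<le> V \<theta> \<phi>" for \<theta> \<phi> by (rule order.trans[OF norm_ge_zero V(1)])
  have E0: "E \<ge> 0" by (simp add: E_def)
  have c0: "c \<ge> 0" using E0 MK M20 D1 G0 \<nu>0 by (simp add: c_def)
  have shift: "norm (regressor_shift a b (0 :: 'n param)) \<le> 2 * ?n * (\<bar>a\<bar> + \<bar>b\<bar>)" for a b
    using norm_regressor_shift_le[of a b "0 :: 'n param"] by simp
  have lower: "norm \<phi> \<le> W \<theta>s \<theta> \<phi>" for \<theta>s \<theta> \<phi>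
    using V(1)[of \<phi> \<theta>] mult_left_mono[OF E1 V0[of \<theta> \<phi>], of \<theta> \<theta>s] by (simp add: W_def)
  have upper: "W \<theta>s \<theta> \<phi> \<le> E * (M * norm \<phi>)" if "\<theta> \<in> S" "\<theta>s \<in> S" for \<theta>s \<theta> \<phi>
    unfolding W_def mult.commute[of "V \<theta> \<phi>"]
    by (intro mult_mono EE that V(2)) (use E0 V0 in auto)
  have step: "W \<theta>s (estimator_step S \<delta> \<phi> e \<theta>) (?F \<theta> \<phi> + regressor_shift e r 0)
        \<le> lam * W \<theta>s \<theta> \<phi> + c * (\<bar>r\<bar> + \<bar>d\<bar>)"
    if \<theta>s: "\<theta>s \<in> S" and \<theta>: "\<theta> \<in> S" and e: "e = \<phi> \<bullet> \<theta>s + d - \<phi> \<bullet> \<theta>" for \<theta>s \<theta> \<phi> e r d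
  proof -
    define \<theta>' where "\<theta>' = estimator_step S \<delta> \<phi> e \<theta>"
    define \<phi>' where "\<phi>' = ?F \<theta> \<phi> + regressor_shift e r 0"
    have \<theta>': "\<theta>' \<in> S"
      unfolding \<theta>'_def estimator_step_def using S by (intro closest_point_in_set compact_imp_closed) auto
    have "0 \<le> W \<theta>s \<theta> \<phi>" by (rule order.trans[OF norm_ge_zero lower])
    then have lamW: "0 \<le> lam * W \<theta>s \<theta> \<phi>" using \<mu>0 \<mu>(2) by simp
    have "W \<theta>s \<theta>' \<phi>' \<le> lam * W \<theta>s \<theta> \<phi> + c * (\<bar>r\<bar> + \<bar>d\<bar>)"
    proof (cases "\<bar>d\<bar> < \<nu> * norm \<phi>")
      case True
      define x where "x = \<bar>e\<bar> / norm \<phi>"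
      have \<phi>: "norm \<phi> > 0" using True by (cases "\<phi> = 0") auto
      note est = estimator_step_good[OF S(2,3) \<theta> \<theta>s \<nu>\<delta> True e, folded x_def \<theta>'_def]
      have x0: "x \<ge> 0" by (simp add: x_def)
      have "\<bar>e\<bar> \<le> D * norm \<phi>"
      proof -
        have "(2 * set_norm S + \<nu>) * norm \<phi> \<le> D * norm \<phi>"
          using \<nu>1 by (intro mult_right_mono) (auto simp: D_def)
        with est(1) show ?thesis by linarith
      qed
      then have xD: "x \<le> D" using \<phi> by (simp add: x_def field_simps)
      have ex: "\<bar>e\<bar> = x * norm \<phi>" using \<phi> by (simp add: x_def)
      \<comment> \<open>With the norm still frozen at \<open>\<theta>\<close>, the error input acts
        as a perturbation of relative size \<open>x\<close>; the move to the norm at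
        \<open>\<theta>'\<close> follows.\<close>
      have Vphi: "V \<theta> \<phi>' \<le> (\<mu> + M2 * x) * V \<theta> \<phi> + M2 * \<bar>r\<bar>"
      proof -
        have "V \<theta> \<phi>' \<le> V \<theta> (?F \<theta> \<phi>) + V \<theta> (regressor_shift e r 0)"
          unfolding \<phi>'_def by (rule V(4))
        also have "\<dots> \<le> \<mu> * V \<theta> \<phi> + M * (2 * ?n * (\<bar>e\<bar> + \<bar>r\<bar>))"
          by (intro add_mono V(3)[OF \<theta>] order.trans[OF V(2)[OF \<theta>]] mult_left_mono shift MK(1))
        also have "\<dots> = \<mu> * V \<theta> \<phi> + M2 * x * norm \<phi> + M2 * \<bar>r\<bar>"
          by (simp add: M2_def ex algebra_simps)
        also have "\<dots> \<le> \<mu> * V \<theta> \<phi> + M2 * x * V \<theta> \<phi> + M2 * \<bar>r\<bar>"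
          using M20 x0 V(1) by (intro add_right_mono add_left_mono mult_left_mono) auto
        finally show ?thesis by (simp add: algebra_simps)
      qed
      have "V \<theta>' \<phi>' \<le> V \<theta> \<phi>' + K * norm (\<theta>' - \<theta>) * norm \<phi>'" by (rule Vlip[OF \<theta> \<theta>'])
      also have "\<dots> \<le> V \<theta> \<phi>' + K * x * V \<theta> \<phi>'"
        using MK(2) est(2) x0 by (intro add_left_mono mult_mono V(1)) auto
      also have "\<dots> = (1 + K * x) * V \<theta> \<phi>'" by (simp add: algebra_simps)
      also have "\<dots> \<le> (1 + K * x) * ((\<mu> + M2 * x) * V \<theta> \<phi> + M2 * \<bar>r\<bar>)"
        using MK(2) x0 by (intro mult_left_mono Vphi) auto
      also have "\<dots> = \<mu> * ((1 + K * x) * (1 + M2 / \<mu> * x)) * V \<theta> \<phi> + (1 + K * x) * M2 * \<bar>r\<bar>"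
        using \<mu>0 by (simp add: field_simps)
      also have "\<dots> \<le> \<mu> * exp (K2 * x) * V \<theta> \<phi> + (1 + K * D) * M2 * \<bar>r\<bar>"
      proof -
        \<comment> \<open>Both factors, from the change of norm and from the error input, are merged
          by \<open>1 + s \<le> exp s\<close>; hence the form of \<open>K2\<close>.\<close>
        have "(1 + K * x) * (1 + M2 / \<mu> * x) \<le> exp (K * x) * exp (M2 / \<mu> * x)"
          using MK(2) M20 x0 \<mu>0 by (intro mult_mono exp_ge_add_one_self) auto
        also have "\<dots> = exp (K2 * x)" by (simp add: K2_def exp_add[symmetric] distrib_right)
        finally show ?thesis
          using \<mu>0 V0 MK(2) M20 xD by (intro add_mono mult_right_mono mult_left_mono) auto
      qed
      finally have VV: "V \<theta>' \<phi>' \<le> \<mu> * exp (K2 * x) * V \<theta> \<phi> + (1 + K * D) * M2 * \<bar>r\<bar>" .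
      let ?v = "(norm (\<theta> - \<theta>s))\<^sup>2" and ?v' = "(norm (\<theta>' - \<theta>s))\<^sup>2"
      have "H * x\<^sup>2 \<le> H * (2 * ?v - 2 * ?v' + 4 * \<nu>\<^sup>2)"
        using est(3) H0 by (intro mult_left_mono) auto
      \<comment> \<open>The quadratic \<open>H * x\<^sup>2\<close> is paid for by the drop from
        \<open>?v\<close> to \<open>?v'\<close>, so no accumulation over time remains.\<close>
      then have expo: "K2 * x + 2 * H * ?v' \<le> 2 * \<epsilon> + 2 * H * ?v"
        using H[of x] \<nu>H by (simp add: algebra_simps)
      have "W \<theta>s \<theta>' \<phi>' \<le> (\<mu> * exp (K2 * x) * V \<theta> \<phi> + (1 + K * D) * M2 * \<bar>r\<bar>) * exp (2 * H * ?v')"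
        unfolding W_def by (intro mult_right_mono VV) auto
      also have "\<dots> = \<mu> * V \<theta> \<phi> * exp (K2 * x + 2 * H * ?v') + (1 + K * D) * M2 * \<bar>r\<bar> * exp (2 * H * ?v')"
        by (simp add: exp_add algebra_simps)
      also have "\<dots> \<le> \<mu> * V \<theta> \<phi> * exp (2 * \<epsilon> + 2 * H * ?v) + (1 + K * D) * M2 * \<bar>r\<bar> * E"
        using \<mu>0 V0 MK(2) M20 D1 expo
        by (intro add_mono mult_left_mono EE \<theta>' \<theta>s) auto
      also have "\<mu> * V \<theta> \<phi> * exp (2 * \<epsilon> + 2 * H * ?v) = lam * W \<theta>s \<theta> \<phi>"
        by (simp add: W_def exp_add lam\<mu>[symmetric])
      also have "(1 + K * D) * M2 * \<bar>r\<bar> * E \<le> c * (\<bar>r\<bar> + \<bar>d\<bar>)"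
      proof -
        have "E * ((1 + K * D) * M2) \<le> c" using E0 MK G0 D1 \<nu>0 by (simp add: c_def)
        then have "E * ((1 + K * D) * M2) * \<bar>r\<bar> \<le> c * (\<bar>r\<bar> + \<bar>d\<bar>)"
          using c0 by (intro mult_mono) auto
        then show ?thesis by (simp add: mult_ac)
      qed
      finally show ?thesis by simp
    next
      case False
      \<comment> \<open>This case includes \<open>\<phi> = 0\<close>. Whether or not the estimate is
        updated, \<open>\<theta>'\<close> stays in \<open>S\<close> and the weight is at most
        \<open>E\<close>; the inputs alone bound the new value, and the nonnegative term
        \<open>lam * W \<theta>s \<theta> \<phi>\<close> is simply added.\<close>
      then have \<phi>d: "norm \<phi> \<le> \<bar>d\<bar> / \<nu>" using \<nu>0 by (simp add: field_simps)
      have "\<bar>\<phi> \<bullet> (\<theta>s - \<theta>)\<bar> \<le> norm \<phi> * D"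
        by (intro order.trans[OF Cauchy_Schwarz_ineq2] mult_left_mono dist \<theta> \<theta>s) simp
      then have "\<bar>e\<bar> \<le> D * norm \<phi> + \<bar>d\<bar>" by (simp add: e inner_diff_right mult.commute)
      then have sh: "norm (regressor_shift e r (0 :: 'n param)) \<le> 2 * ?n * (D * norm \<phi> + \<bar>d\<bar> + \<bar>r\<bar>)"
        by (intro order.trans[OF shift] mult_left_mono) auto
      have "norm \<phi>' \<le> G * norm \<phi> + 2 * ?n * (D * norm \<phi> + \<bar>d\<bar> + \<bar>r\<bar>)"
        unfolding \<phi>'_def by (intro norm_triangle_mono GL(3) \<theta> sh)
      also have "\<dots> = (G + 2 * ?n * D) * norm \<phi> + 2 * ?n * (\<bar>d\<bar> + \<bar>r\<bar>)" by (simp add: algebra_simps)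
      also have "\<dots> \<le> (G + 2 * ?n * D) * ((\<bar>r\<bar> + \<bar>d\<bar>) / \<nu>) + 2 * ?n * (\<bar>d\<bar> + \<bar>r\<bar>)"
        using G0 D1 \<nu>0 by (intro add_right_mono mult_left_mono order.trans[OF \<phi>d] divide_right_mono) auto
      also have "\<dots> = ((G + 2 * ?n * D) / \<nu> + 2 * ?n) * (\<bar>r\<bar> + \<bar>d\<bar>)"
        by (simp add: algebra_simps add_divide_distrib)
      finally have "E * (M * norm \<phi>') \<le> E * (M * (((G + 2 * ?n * D) / \<nu> + 2 * ?n) * (\<bar>r\<bar> + \<bar>d\<bar>)))"
        using E0 MK(1) by (intro mult_left_mono) auto
      also have "\<dots> = (E * (M * ((G + 2 * ?n * D) / \<nu> + 2 * ?n))) * (\<bar>r\<bar> + \<bar>d\<bar>)" by (simp add: mult.assoc)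
      also have "\<dots> \<le> c * (\<bar>r\<bar> + \<bar>d\<bar>)"
        using E0 MK M20 D1 by (intro mult_right_mono) (auto simp: c_def)
      finally show ?thesis using upper[OF \<theta>' \<theta>s, of \<phi>'] lamW by linarith
    qed
    then show ?thesis by (simp add: \<theta>'_def \<phi>'_def)
  qed
  show ?thesis
  proof (rule exI[of _ W], rule exI[of _ "E * M"], rule conjI[OF _ exI[of _ c]];
      (intro conjI ballI allI impI)?)
    show "W \<theta>s \<theta> \<phi> \<le> E * M * norm \<phi>" if "\<theta>s \<in> S" "\<theta> \<in> S" for \<theta>s \<theta> \<phi>
      using upper[OF that(2,1)] by (simp add: mult.assoc)
  qed (use E0 MK(1) c0 lower step in auto)
qed

section \<open>Unrolling the one-step inequality along the closed loop\<close>

theorem theorem1: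
  fixes S :: "'n::{finite,linorder} param set"
    and Astar :: "real poly"
    and \<delta> :: ereal
    and lam :: real
  assumes "admissible_params S"
    and "stable_target (2 * CARD('n)) Astar"
    and "0 < \<delta>"
    and "max_root_modulus (2 * CARD('n)) Astar < lam"
    and "lam < 1"
  shows "\<exists>c>0. \<forall>t0. \<forall>\<theta>0\<in>S. \<forall>\<theta>star\<in>S. \<forall>\<phi>0 ystar d y u \<theta>h.
    bounded (range ystar) \<longrightarrow> bounded (range d) \<longrightarrow>
    closed_loop S Astar \<delta> t0 \<theta>0 \<theta>star \<phi>0 ystar d y u \<theta>h \<longrightarrow>
    (\<forall>k\<ge>t0. norm (regressor y u k :: 'n param) \<le>
      c * lam powi (k - t0) * norm \<phi>0 +
      (\<Sum>j\<in>{t0..<k}. c * lam powi (k - 1 - j) *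
         (\<bar>filtered_reference Astar \<theta>h ystar j\<bar> + \<bar>d j\<bar>)))"
proof -
  have S: "S \<noteq> {}" "compact S" using assms(1) by (auto simp: admissible_params_def)
  have lam0: "0 < lam"
    using target_decay(1)[OF assms(2) _ assms(4)] assms(5) by simp
  obtain W M c1 where W': "M \<ge> 0" "c1 \<ge> 0" "\<forall>\<theta>s\<in>S. \<forall>\<theta>\<in>S. \<forall>\<phi> d r e.
    norm \<phi> \<le> W \<theta>s \<theta> \<phi> \<and> W \<theta>s \<theta> \<phi> \<le> M * norm \<phi> \<and>
    (e = \<phi> \<bullet> \<theta>s + d - \<phi> \<bullet> \<theta> \<longrightarrow>
      W \<theta>s (estimator_step S \<delta> \<phi> e \<theta>) (frozen_map Astar \<theta> \<phi> + regressor_shift e r 0)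
        \<le> lam * W \<theta>s \<theta> \<phi> + c1 * (\<bar>r\<bar> + \<bar>d\<bar>))"
    using closed_loop_lyapunov[OF assms] by blast
  \<comment> \<open>Dominates both \<open>M\<close> and \<open>c1\<close>; the summand 1 makes it
    positive.\<close>
  define c where "c = M + c1 + 1"
  have bound: "norm (regressor y u k :: 'n param) \<le> c * lam powi (k - t0) * norm \<phi>0 +
      (\<Sum>j\<in>{t0..<k}. c * lam powi (k - 1 - j) * (\<bar>filtered_reference Astar \<theta>h ystar j\<bar> + \<bar>d j\<bar>))"
    if \<theta>: "\<theta>0 \<in> S" "\<theta>star \<in> S" and loop: "closed_loop S Astar \<delta> t0 \<theta>0 \<theta>star \<phi>0 ystar d y u \<theta>h"
      and "k \<ge> t0" for t0 k \<theta>0 \<theta>star \<phi>0 ystar d y u \<theta>h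
  proof -
    define \<phi> where "\<phi> t = (regressor y u t :: 'n param)" for t
    define f where "f t = \<bar>filtered_reference Astar \<theta>h ystar t\<bar> + \<bar>d t\<bar>" for t
    have init: "\<phi> t0 = \<phi>0" "\<theta>h t0 = \<theta>0" using loop by (auto simp: closed_loop_def \<phi>_def)
    have y: "y (t + 1) = \<phi> t \<bullet> \<theta>star + d t" if "t \<ge> t0" for t
      using loop that by (auto simp: closed_loop_def \<phi>_def)
    have \<theta>h: "\<theta>h (t + 1) = estimator_step S \<delta> (\<phi> t) (y (t + 1) - \<phi> t \<bullet> \<theta>h t) (\<theta>h t)" if "t \<ge> t0" for t
      using loop that by (auto simp: closed_loop_def \<phi>_def)
    have u: "u t = - (\<Sum>i\<in>UNIV. L_gain Astar (\<theta>h (t - 1)) $ i * u (t - int (idx i)))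
      - (\<Sum>i\<in>UNIV. P_gain Astar (\<theta>h (t - 1)) $ i * (y (t - int (idx i)) - ystar (t - int (idx i))))"
      if "t \<ge> t0 + 1" for t using loop that by (auto simp: closed_loop_def)
    have u': "u (t + 1) = control_map (L_gain Astar (\<theta>h t), P_gain Astar (\<theta>h t)) (\<phi> t)
        + filtered_reference Astar \<theta>h ystar t" if "t \<ge> t0" for t
      using u[of "t + 1"] that
      by (simp add: control_map_def filtered_reference_def \<phi>_def regressor_def
          right_diff_distrib sum_subtractf)
    have \<phi>': "\<phi> (t + 1) = frozen_map Astar (\<theta>h t) (\<phi> t)
        + regressor_shift (y (t + 1) - \<phi> t \<bullet> \<theta>h t) (filtered_reference Astar \<theta>h ystar t) 0"
      if "t \<ge> t0" for t
    proof -
      have "\<phi> (t + 1) = regressor_shift (y (t + 1)) (u (t + 1)) (\<phi> t)"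
        unfolding \<phi>_def by (rule regressor_Suc)
      then show ?thesis
        unfolding frozen_map_def regressor_shift_add[symmetric] by (simp add: u'[OF that])
    qed
    have mem: "\<theta>h t \<in> S" if "t \<ge> t0" for t
      using that
    proof (induction t rule: int_ge_induct)
      case base
      show ?case using init \<theta> by simp
    next
      case (step t)
      show ?case
        unfolding \<theta>h[OF step(1)] estimator_step_def using S
        by (intro closest_point_in_set compact_imp_closed) auto
    qed
    define w where "w t = W \<theta>star (\<theta>h t) (\<phi> t)" for t
    \<comment> \<open>Discrete variation of constants. In the step, \<open>lam\<close> raises every
      old exponent by one, and the new input enters at \<open>j = k\<close> with exponent 0.\<close>
    have "w k \<le> lam powi (k - t0) * w t0 + (\<Sum>j\<in>{t0..<k}. c1 * lam powi (k - 1 - j) * f j)"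
      using \<open>k \<ge> t0\<close>
    proof (induction k rule: int_ge_induct)
      case (step k)
      have "w (k + 1) \<le> lam * w k + c1 * f k"
        using W'(3) mem[OF step(1)] \<theta>(2) y[OF step(1)]
        unfolding w_def \<phi>'[OF step(1)] \<theta>h[OF step(1)] f_def by simp
      also have "\<dots> \<le> lam * (lam powi (k - t0) * w t0 + (\<Sum>j\<in>{t0..<k}. c1 * lam powi (k - 1 - j) * f j)) + c1 * f k"
        using lam0 step by (intro add_right_mono mult_left_mono) auto
      also have "lam * (lam powi (k - t0) * w t0 + (\<Sum>j\<in>{t0..<k}. c1 * lam powi (k - 1 - j) * f j))
          = lam powi (k + 1 - t0) * w t0 + (\<Sum>j\<in>{t0..<k}. c1 * lam powi (k + 1 - 1 - j) * f j)"
      proof -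
        have pw: "lam * lam powi (k - t0) = lam powi (k + 1 - t0)"
          "lam * lam powi (k - 1 - j) = lam powi (k + 1 - 1 - j)" for j
          using lam0 power_int_add_1'[of lam "k - t0"] power_int_add_1'[of lam "k - 1 - j"]
          by (simp_all add: algebra_simps)
        show ?thesis
          unfolding pw(1)[symmetric] pw(2)[symmetric] by (simp add: distrib_left sum_distrib_left mult_ac)
      qed
      also have "\<dots> + c1 * f k = lam powi (k + 1 - t0) * w t0 + (\<Sum>j\<in>{t0..<k + 1}. c1 * lam powi (k + 1 - 1 - j) * f j)"
      proof -
        have "{t0..<k + 1} = insert k {t0..<k}" using step(1) by auto
        then show ?thesis by simp
      qed
      finally show ?case .
    qed simp
    moreover have "norm (\<phi> k) \<le> w k" "w t0 \<le> M * norm \<phi>0"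
      using W'(3) mem \<theta>(2) \<open>k \<ge> t0\<close> init by (auto simp: w_def)
    moreover have "lam powi (k - t0) * (M * norm \<phi>0) \<le> c * lam powi (k - t0) * norm \<phi>0"
    proof -
      have "M * (lam powi (k - t0) * norm \<phi>0) \<le> c * (lam powi (k - t0) * norm \<phi>0)"
        using W' lam0 by (intro mult_right_mono) (auto simp: c_def)
      then show ?thesis by (simp add: mult_ac)
    qed
    moreover have "lam powi (k - t0) * w t0 \<le> lam powi (k - t0) * (M * norm \<phi>0)"
      using calculation lam0 by (intro mult_left_mono) auto
    moreover have "(\<Sum>j\<in>{t0..<k}. c1 * lam powi (k - 1 - j) * f j) \<le> (\<Sum>j\<in>{t0..<k}. c * lam powi (k - 1 - j) * f j)"
      using W' lam0 by (intro sum_mono mult_right_mono) (auto simp: c_def f_def)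
    ultimately show ?thesis unfolding \<phi>_def f_def by linarith
  qed
  have "c > 0" using W' by (simp add: c_def)
  with bound show ?thesis by (intro exI[of _ c]) blast
qed

end
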